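(* Let $\alpha(1),\dots,\alpha(d)\in\mathbb{N}_0^n$ be distinct vectors spanning $\mathbb{R}^n$, let $f=\sum_{j=1}^d b_jZ^{\alpha(j)}\in\mathbb{C}[Z_1,\dots,Z_n]$ with $b_j\in\mathbb{C}^*$, and let $r\in\mathbb{N}$, $r\ge1$. (1) One has $\mathbb{R}^n\setminus\mathcal{L}\mathcal{A}(\tilde f_r)\subset\mathbb{R}^n\setminus\mathcal{A}_f$, and for any $w\in\mathbb{R}^n\setminus\mathcal{L}\mathcal{A}(\tilde f_r)$ there exists a certificate for $w$ of degree at most $2\cdot r^n\cdot\deg(f)$, which can be computed explicitly. (2) The certificate determines the order of the complement component of $\mathcal{A}_f$ to which $w$ belongs.
   Context: $\mathcal{A}_f=\{(\log|z_1|,\dots,\log|z_n|) : z\in(\mathbb{C}\setminus\{0\})^n,\ f(z)=0\}$ is the amoeba of $f$; $\deg$ is total degree; $\mathbb{C}^*=\mathbb{C}\setminus\{0\}$. For a nonzero polynomial $h=\sum_{j=1}^e c_jZ^{\beta(j)}$ (distinct exponents, $c_j\ne0$) and $v\in\mathbb{R}^n$, $h\{v\}$ is the list $(|c_j|e^{\langle\beta(j),v\rangle})_{1\le j\le e}$. A list of positive reals is lopsided if one of its numbers (the dominating one) is greater than the sum of all the others. $\mathcal{L}\mathcal{A}(h)=\{v\in\mathbb{R}^n : h\{v\}\text{ is not lopsided}\}$. For $r\ge1$, $$\tilde f_r(Z)=\prod_{k_1=0}^{r-1}\cdots\prod_{k_n=0}^{r-1}f\bigl(e^{2\pi ik_1/r}Z_1,\dots,e^{2\pi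 ik_n/r}Z_n\bigr).$$ Real and imaginary parts $h^{\mathrm{re}},h^{\mathrm{im}}\in\mathbb{R}[X_1,\dots,X_n,Y_1,\dots,Y_n]$ of $h\in\mathbb{C}[Z]$ are defined by $h(X+iY)=h^{\mathrm{re}}(X,Y)+i\,h^{\mathrm{im}}(X,Y)$. Lopsidedness certificate. Let $h=\sum_{j=1}^e c_jZ^{\beta(j)}$ with, after reordering, $c_1$ dominating: $|c_1|>\sum_{i\ge2}|c_i|$ (i.e. $h\{0\}$ is lopsided). Put $u_i=(c_iZ^{\beta(i)})^{\mathrm{re}}/|c_i|$, $v_i=(c_iZ^{\beta(i)})^{\mathrm{im}}/|c_i|$, $s_i=u_i^2+v_i^2-1$ for $1\le i\le e$, $s_{e+1}=h^{\mathrm{re}}$, $s_{e+2}=h^{\mathrm{im}}$, and $\gamma=|c_1|^2-(\sum_{i\ge2}|c_i|)^2>0$. The lopsidedness certificate of $h$ (at the point $\mathbf{1}=(1,\dots,1)$) is the identity $\sum_{i=1}^{e+2}s_ig_i+H+1=0$ in $\mathbb{R}[X,Y]$, with $\gamma g_1=|c_1|^2$, $\gamma g_i=-|c_i|\sum_{k\ge2}|c_k|$ for $2\le i\le e$, $\gamma g_{e+1}$ and $\gamma g_{e+2}$ the real and imaginary parts of $-c_1Z^{\beta(1)}+\sum_{i\ge2}c_iZ^{\beta(i)}$, and $\gamma H=\sum_{2\le i<j\le e}|c_i||c_j|\bigl((u_i-u_j)^2+(v_i-v_j)^2\bigr)$. Its degree is the maximum of the total degrees of the summands $s_ig_i$ and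 $H$. The term with index $1$ occurs in a distinguished way in it (it is the dominating term). For $w\in\mathbb{R}^n$ let $\lambda_i=e^{w_i}$ and $g(Z)=f(\lambda_1Z_1,\dots,\lambda_nZ_n)$, so that $w\in\mathcal{A}_f$ if and only if $\mathbf{1}$ lies in the unlog amoeba $\mathcal{U}_g=\{(|z_1|,\dots,|z_n|) : g(z)=0\}$. Let $\tilde g_r$ be defined from $g$ as $\tilde f_r$ is from $f$. A certificate for $w$ means here the lopsidedness certificate of $\tilde g_r$ (with its distinguished dominating term), which certifies $\mathbf{1}\notin\mathcal{U}_g$. That it determines the order means that, for given $f$ and $r$, the order of $w$ is a function of this certificate. The order $\nu\in\mathbb{Z}^n$ of a point $w\in\mathbb{R}^n\setminus\mathcal{A}_f$ (constant on each connected component of the complement) is $$\nu_j=\frac1{(2\pi i)^n}\int_{\mathrm{Log}^{-1}(w)}\frac{z_j\,\partial_jf(z)}{f(z)}\,\frac{dz_1\cdots dz_n}{z_1\cdots z_n},\quad 1\le j\le n,$$ with $\mathrm{Log}(z)=(\log|z_1|,\dots,\log|z_n|)$. *)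

theory Defs
  imports "HOL-Analysis.Analysis" "HOL-Library.Poly_Mapping"
begin

section \<open>Multivariate polynomials\<close>

text \<open>
  A polynomial over \<open>'a\<close> in the variables \<open>Z\<^sub>k\<close>, \<open>k :: 'v\<close>, is a finitely supported map from
  exponent vectors in \<open>nat ^ 'v\<close> to coefficients, with the convolution product of
  \<^theory>\<open>HOL-Library.Poly_Mapping\<close>. Thus \<open>Poly_Mapping.single m c\<close> is the term \<open>c Z\<^sup>m\<close>.
\<close>

type_synonym ('v, 'a) mpoly = "(nat ^ 'v) \<Rightarrow>\<^sub>0 'a"

definition mp_const :: "'a::zero \<Rightarrow> ('v::finite, 'a) mpoly" where
  "mp_const c = Poly_Mapping.single 0 c"

definition mp_var :: "'v::finite \<Rightarrow> ('v, 'a::zero_neq_one) mpoly" where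
  "mp_var k = Poly_Mapping.single (axis k 1) 1"

definition total_degree :: "('v::finite, 'a::zero) mpoly \<Rightarrow> nat" where
  "total_degree p = Max (insert 0 ((\<lambda>m. \<Sum>k\<in>UNIV. m $ k) ` Poly_Mapping.keys p))"

text \<open>Substitution of \<open>x k\<close> for the variables, the coefficients being mapped by \<open>\<phi>\<close>.\<close>

definition mp_subst ::
  "('a::zero \<Rightarrow> 'b::comm_semiring_1) \<Rightarrow> ('v::finite \<Rightarrow> 'b) \<Rightarrow> ('v, 'a) mpoly \<Rightarrow> 'b" where
  "mp_subst \<phi> x p =
     (\<Sum>m\<in>Poly_Mapping.keys p. \<phi> (Poly_Mapping.lookup p m) * (\<Prod>k\<in>UNIV. x k ^ (m $ k)))"

definition mp_eval :: "('v::finite, 'a::comm_semiring_1) mpoly \<Rightarrow> ('v \<Rightarrow> 'a) \<Rightarrow> 'a" where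
  "mp_eval p x = mp_subst (\<lambda>c. c) x p"

text \<open>\<open>rescale c f\<close> is \<open>f(c\<^sub>1 Z\<^sub>1, \<dots>, c\<^sub>n Z\<^sub>n)\<close>.\<close>

definition rescale ::
  "('v::finite \<Rightarrow> 'a) \<Rightarrow> ('v, 'a::comm_semiring_1) mpoly \<Rightarrow> ('v, 'a) mpoly" where
  "rescale c f = mp_subst mp_const (\<lambda>k. mp_const (c k) * mp_var k) f"

definition exponent_vector :: "nat ^ 'n \<Rightarrow> real ^ 'n" where
  "exponent_vector m = (\<chi> k. real (m $ k))"


section \<open>Amoebas and lopsidedness\<close>

definition Log_map :: "complex ^ 'n \<Rightarrow> real ^ 'n" where
  "Log_map z = (\<chi> k. ln (cmod (z $ k)))"

definition amoeba :: "('n::finite, complex) mpoly \<Rightarrow> (real ^ 'n) set" where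
  "amoeba f = {Log_map z |z. (\<forall>k. z $ k \<noteq> 0) \<and> mp_eval f (($) z) = 0}"

definition unlog_amoeba :: "('n::finite, complex) mpoly \<Rightarrow> (real ^ 'n) set" where
  "unlog_amoeba g = {(\<chi> k. cmod (z $ k)) |z. mp_eval g (($) z) = 0}"

text \<open>
  A list of positive reals is represented by a family \<open>x\<close> on a finite index set \<open>I\<close>, so that its
  dominating member can be identified by its index.
\<close>

definition dominating :: "'i set \<Rightarrow> ('i \<Rightarrow> real) \<Rightarrow> 'i \<Rightarrow> bool" where
  "dominating I x i \<longleftrightarrow> i \<in> I \<and> x i > (\<Sum>j\<in>I - {i}. x j)"

definition lopsided :: "'i set \<Rightarrow> ('i \<Rightarrow> real) \<Rightarrow> bool" where
  "lopsided I x \<longleftrightarrow> (\<exists>i. dominating I x i)"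

text \<open>The list \<open>h{v}\<close>, indexed by the exponents of \<open>h\<close>.\<close>

definition term_moduli :: "('n::finite, complex) mpoly \<Rightarrow> real ^ 'n \<Rightarrow> nat ^ 'n \<Rightarrow> real" where
  "term_moduli h v m = cmod (Poly_Mapping.lookup h m) * exp (exponent_vector m \<bullet> v)"

definition lopsided_amoeba :: "('n::finite, complex) mpoly \<Rightarrow> (real ^ 'n) set" where
  "lopsided_amoeba h = {v. \<not> lopsided (Poly_Mapping.keys h) (term_moduli h v)}"

definition cyclic_product :: "nat \<Rightarrow> ('n::finite, complex) mpoly \<Rightarrow> ('n, complex) mpoly" where
  "cyclic_product r f =
     (\<Prod>k\<in>{k :: 'n \<Rightarrow> nat. \<forall>j. k j < r}.
        rescale (\<lambda>j. exp (2 * of_real pi * \<i> * of_nat (k j) / of_nat r)) f)"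


section \<open>Lopsidedness certificates\<close>

text \<open>
  Polynomials in \<open>X\<^sub>k, Y\<^sub>k\<close> have variables indexed by \<open>'n + 'n\<close>: \<open>Inl k\<close> stands for \<open>X\<^sub>k\<close> and
  \<open>Inr k\<close> for \<open>Y\<^sub>k\<close>. The function \<open>split_vars\<close> expands \<open>h(X + iY)\<close> with complex coefficients.
\<close>

definition split_vars :: "('n::finite, complex) mpoly \<Rightarrow> ('n + 'n, complex) mpoly" where
  "split_vars h = mp_subst mp_const (\<lambda>k. mp_var (Inl k) + mp_const \<i> * mp_var (Inr k)) h"

definition re_part :: "('n::finite, complex) mpoly \<Rightarrow> ('n + 'n, real) mpoly" where
  "re_part h = Poly_Mapping.map Re (split_vars h)"

definition im_part :: "('n::finite, complex) mpoly \<Rightarrow> ('n + 'n, real) mpoly" where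
  "im_part h = Poly_Mapping.map Im (split_vars h)"

text \<open>
  A certificate \<open>Certificate [(s\<^sub>1, g\<^sub>1), \<dots>] H\<close> stands for the identity
  \<open>\<Sum>\<^sub>i s\<^sub>i g\<^sub>i + H + 1 = 0\<close>.
\<close>

datatype 'p certificate = Certificate (summands: "('p \<times> 'p) list") (sos_part: 'p)

definition certificate_identity :: "'p::comm_ring_1 certificate \<Rightarrow> bool" where
  "certificate_identity C \<longleftrightarrow> (\<Sum>(s, g)\<leftarrow>summands C. s * g) + sos_part C + 1 = 0"

definition certificate_degree ::
  "('v::finite, 'a::comm_ring_1) mpoly certificate \<Rightarrow> nat" where
  "certificate_degree C =
     Max (insert (total_degree (sos_part C))
            ((\<lambda>(s, g). total_degree (s * g)) ` set (summands C)))"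

text \<open>
  The certificate shows that \<open>1\<close> is not in the unlog amoeba of \<open>g\<close>: all \<open>s\<^sub>i\<close> vanish at every
  zero of \<open>g\<close> on the unit torus, whereas \<open>H\<close> is nonnegative, being a sum of squares.
\<close>

definition certifies_one :: "('n + 'n::finite, real) mpoly certificate \<Rightarrow>
    ('n, complex) mpoly \<Rightarrow> bool" where
  "certifies_one C g \<longleftrightarrow>
     certificate_identity C \<and>
     (\<exists>qs. sos_part C = (\<Sum>q\<leftarrow>qs. q\<^sup>2)) \<and>
     (\<forall>z :: complex ^ 'n. (\<forall>k. cmod (z $ k) = 1) \<and> mp_eval g (($) z) = 0 \<longrightarrow>
        (\<forall>(s, t)\<in>set (summands C).
           mp_eval s (case_sum (\<lambda>k. Re (z $ k)) (\<lambda>k. Im (z $ k))) = 0))"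

text \<open>
  An ordering \<open>\<beta>(1), \<dots>, \<beta>(e)\<close> of the exponents of \<open>h\<close> that starts with the dominating member
  of \<open>h{0}\<close>.
\<close>

definition dominating_enumeration :: "('n::finite, complex) mpoly \<Rightarrow> (nat \<Rightarrow> nat ^ 'n) \<Rightarrow> bool" where
  "dominating_enumeration h \<beta> \<longleftrightarrow>
     bij_betw \<beta> {1..card (Poly_Mapping.keys h)} (Poly_Mapping.keys h) \<and>
     dominating (Poly_Mapping.keys h) (term_moduli h 0) (\<beta> 1)"

definition lopsidedness_certificate ::
  "('n::finite, complex) mpoly \<Rightarrow> (nat \<Rightarrow> nat ^ 'n) \<Rightarrow> ('n + 'n, real) mpoly certificate" where
  "lopsidedness_certificate h \<beta> =
    (let e = card (Poly_Mapping.keys h);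
         c = (\<lambda>i. Poly_Mapping.lookup h (\<beta> i));
         t = (\<lambda>i. Poly_Mapping.single (\<beta> i) (c i));
         u = (\<lambda>i. mp_const (1 / cmod (c i)) * re_part (t i));
         v = (\<lambda>i. mp_const (1 / cmod (c i)) * im_part (t i));
         \<gamma> = (cmod (c 1))\<^sup>2 - (\<Sum>i=2..e. cmod (c i))\<^sup>2;
         a = - t 1 + (\<Sum>i=2..e. t i);
         s = (\<lambda>i. if i \<le> e then (u i)\<^sup>2 + (v i)\<^sup>2 - 1
                  else if i = e + 1 then re_part h
                  else im_part h);
         g = (\<lambda>i. if i = 1 then mp_const ((cmod (c 1))\<^sup>2 / \<gamma>)
                  else if i \<le> e then mp_const (- cmod (c i) * (\<Sum>k=2..e. cmod (c k)) / \<gamma>)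
                  else if i = e + 1 then mp_const (1 / \<gamma>) * re_part a
                  else mp_const (1 / \<gamma>) * im_part a);
         H = mp_const (1 / \<gamma>) *
             (\<Sum>(i, j)\<in>{(i, j). 2 \<le> i \<and> i < j \<and> j \<le> e}.
                mp_const (cmod (c i) * cmod (c j)) * ((u i - u j)\<^sup>2 + (v i - v j)\<^sup>2))
     in Certificate (map (\<lambda>i. (s i, g i)) [1..<e + 3]) H)"

text \<open>\<open>centred w f\<close> is \<open>f(\<lambda>\<^sub>1 Z\<^sub>1, \<dots>, \<lambda>\<^sub>n Z\<^sub>n)\<close> with \<open>\<lambda>\<^sub>k = exp(w\<^sub>k)\<close>.\<close>

definition centred :: "real ^ 'n \<Rightarrow> ('n::finite, complex) mpoly \<Rightarrow> ('n, complex) mpoly" where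
  "centred w f = rescale (\<lambda>k. of_real (exp (w $ k))) f"

definition certificate_for :: "('n::finite, complex) mpoly \<Rightarrow> nat \<Rightarrow> real ^ 'n \<Rightarrow>
    ('n + 'n, real) mpoly certificate \<Rightarrow> bool" where
  "certificate_for f r w C \<longleftrightarrow>
     (\<exists>\<beta>. dominating_enumeration (cyclic_product r (centred w f)) \<beta> \<and>
          C = lopsidedness_certificate (cyclic_product r (centred w f)) \<beta>)"


section \<open>The order of a point in the complement of the amoeba\<close>

definition torus_point :: "real ^ 'n \<Rightarrow> real ^ 'n \<Rightarrow> complex ^ 'n" where
  "torus_point w \<theta> = (\<chi> k. exp (Complex (w $ k) (\<theta> $ k)))"

text \<open>
  The integral of \<open>F dz\<^sub>1 \<dots> dz\<^sub>n\<close> over the torus \<open>Log\<^sup>-\<^sup>1(w)\<close>, parametrized by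
  \<open>z\<^sub>k = exp(w\<^sub>k + i \<theta>\<^sub>k)\<close>, so that \<open>dz\<^sub>k = i z\<^sub>k d\<theta>\<^sub>k\<close>.
\<close>

definition torus_integral :: "real ^ 'n \<Rightarrow> (complex ^ 'n \<Rightarrow> complex) \<Rightarrow> complex" where
  "torus_integral w F =
     integral (cbox 0 (\<chi> k. 2 * pi))
       (\<lambda>\<theta>. F (torus_point w \<theta>) * (\<Prod>k\<in>UNIV. \<i> * torus_point w \<theta> $ k))"

definition partial_deriv :: "'n \<Rightarrow> (complex ^ 'n \<Rightarrow> complex) \<Rightarrow> complex ^ 'n \<Rightarrow> complex" where
  "partial_deriv j F z = deriv (\<lambda>t. F (\<chi> k. if k = j then t else z $ k)) (z $ j)"

definition amoeba_order :: "('n::finite, complex) mpoly \<Rightarrow> real ^ 'n \<Rightarrow> complex ^ 'n" where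
  "amoeba_order f w =
     (\<chi> j. 1 / (2 * of_real pi * \<i>) ^ CARD('n) *
        torus_integral w
          (\<lambda>z. z $ j * partial_deriv j (\<lambda>z. mp_eval f (($) z)) z / mp_eval f (($) z)
               / (\<Prod>k\<in>UNIV. z $ k)))"

end

theory Submission
  imports Defs
begin

text \<open>
  If a term \<open>c Z\<^sup>m\<close> of \<open>h\<close> dominates at \<open>w\<close>, then by Rouche's argument \<open>h\<close> restricted to the torus
  over \<open>w\<close> is nonzero and winds \<open>m\<^sub>j\<close> times around \<open>0\<close> in the \<open>j\<close>-th direction. For \<open>h\<close> the cyclic
  product, whose \<open>r\<^sup>n\<close> factors are translates of \<open>f\<close> on that torus, this is \<open>r\<^sup>n\<close> times the winding
  number of \<open>f\<close>, which is the \<open>j\<close>-th component of the order. So the order is \<open>m\<close> divided by \<open>r\<^sup>n\<close>, and \<open>m\<close>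
  can be read off \<open>s\<^sub>1 = \<Prod>\<^sub>k (X\<^sub>k\<^sup>2 + Y\<^sub>k\<^sup>2)\<^bsup>m\<^sub>k\<^esup> - 1\<close>. The certificate identity is the weighted
  variance formula \<open>(\<Sum>i<j. a\<^sub>i a\<^sub>j (x\<^sub>i - x\<^sub>j)\<^sup>2) = (\<Sum>i. a\<^sub>i) (\<Sum>i. a\<^sub>i x\<^sub>i\<^sup>2) - (\<Sum>i. a\<^sub>i x\<^sub>i)\<^sup>2\<close>, applied to
  real and imaginary parts.
\<close>

section \<open>Substitution and evaluation\<close>

text \<open>Substitution respects sums and products only if the coefficient map does. The two
  instances needed are \<open>mp_const\<close>, for substituting polynomials into polynomials, and
  the identity, for evaluation.\<close>

locale coefficient_hom =
  fixes \<phi> :: "'a::comm_semiring_1 \<Rightarrow> 'b::comm_semiring_1"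
  assumes zero: "\<phi> 0 = 0" and one: "\<phi> 1 = 1"
    and add: "\<phi> (a + b) = \<phi> a + \<phi> b" and mult: "\<phi> (a * b) = \<phi> a * \<phi> b"
begin

text \<open>Indices outside the support contribute nothing since \<phi> maps 0 to 0. A common index
  set is needed for sums, where coefficients may cancel and the supports differ.\<close>

lemma mp_subst_superset:
  assumes "finite A" "Poly_Mapping.keys p \<subseteq> A"
  shows "mp_subst \<phi> x p = (\<Sum>m\<in>A. \<phi> (Poly_Mapping.lookup p m) * (\<Prod>k\<in>UNIV. x k ^ (m $ k)))"
  unfolding mp_subst_def
  by (rule sum.mono_neutral_left) (use assms in \<open>auto simp: in_keys_iff zero\<close>)

lemma mp_subst_add: "mp_subst \<phi> x (p + q) = mp_subst \<phi> x p + mp_subst \<phi> x q"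
proof -
  let ?A = "Poly_Mapping.keys p \<union> Poly_Mapping.keys q"
  show ?thesis
    by (subst (1 2 3) mp_subst_superset[of ?A])
       (auto simp: Poly_Mapping.keys_add lookup_add add distrib_right sum.distrib)
qed

lemma mp_subst_zero [simp]: "mp_subst \<phi> x 0 = 0"
  by (simp add: mp_subst_def)

lemma mp_subst_single [simp]:
  "mp_subst \<phi> x (Poly_Mapping.single m c) = \<phi> c * (\<Prod>k\<in>UNIV. x k ^ (m $ k))"
  by (subst mp_subst_superset[of "{m}"]) auto

lemma mp_subst_const [simp]: "mp_subst \<phi> x (mp_const c) = \<phi> c"
  by (simp add: mp_const_def)

lemma mp_subst_one [simp]: "mp_subst \<phi> x 1 = 1"
  using mp_subst_single[of x 0 1] by (simp add: one)

lemma mp_subst_sum: "mp_subst \<phi> x (sum p I) = (\<Sum>i\<in>I. mp_subst \<phi> x (p i))"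
  by (induction I rule: infinite_finite_induct) (auto simp: mp_subst_add)

end

lemma poly_mapping_eq_sum_single:
  "p = (\<Sum>m\<in>Poly_Mapping.keys p. Poly_Mapping.single m (Poly_Mapping.lookup p m))"
  by (rule poly_mapping_eqI)
     (auto simp: lookup_sum lookup_single when_def in_keys_iff sum.delta if_distrib cong: if_cong)

context coefficient_hom
begin

lemma mp_subst_mult: "mp_subst \<phi> x (p * q) = mp_subst \<phi> x p * mp_subst \<phi> x q"
proof -
  have "p * q = (\<Sum>m\<in>Poly_Mapping.keys p. \<Sum>l\<in>Poly_Mapping.keys q.
      Poly_Mapping.single (m + l) (Poly_Mapping.lookup p m * Poly_Mapping.lookup q l))"
    by (subst poly_mapping_eq_sum_single[of p], subst poly_mapping_eq_sum_single[of q])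
       (simp add: sum_product mult_single)
  then show ?thesis
    by (simp add: mp_subst_sum mult power_add prod.distrib)
       (simp add: mp_subst_def sum_product mult_ac)
qed

lemma mp_subst_prod: "mp_subst \<phi> x (prod p I) = (\<Prod>i\<in>I. mp_subst \<phi> x (p i))"
  by (induction I rule: infinite_finite_induct) (auto simp: mp_subst_mult)

lemma mp_subst_power: "mp_subst \<phi> x (p ^ n) = mp_subst \<phi> x p ^ n"
  by (induction n) (auto simp: mp_subst_mult)

end

section \<open>Constant polynomials and evaluation\<close>

lemma mp_const_zero [simp]: "mp_const 0 = 0"
  by (simp add: mp_const_def)

lemma mp_const_one [simp]: "mp_const 1 = 1"
  by (simp add: mp_const_def)

lemma mp_const_add: "mp_const (a + b) = mp_const a + mp_const b"
  by (simp add: mp_const_def Poly_Mapping.single_add)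

lemma mp_const_mult: "mp_const (a * b) = mp_const a * mp_const b"
  by (simp add: mp_const_def mult_single)

lemma mp_const_uminus: "mp_const (- a :: 'a::comm_ring_1) = - mp_const a"
  by (simp add: mp_const_def Poly_Mapping.single_uminus)

lemma mp_const_diff: "mp_const (a - b :: 'a::comm_ring_1) = mp_const a - mp_const b"
  by (simp add: mp_const_def Poly_Mapping.single_diff)

lemma mp_const_sum: "mp_const (sum f I) = (\<Sum>i\<in>I. mp_const (f i))"
  by (induction I rule: infinite_finite_induct) (auto simp: mp_const_add)

lemma mp_const_power: "mp_const (a ^ n) = mp_const a ^ n"
  by (induction n) (auto simp: mp_const_mult)

interpretation const_hom: coefficient_hom mp_const
  by unfold_locales (simp_all add: mp_const_add mp_const_mult)

interpretation eval_hom: coefficient_hom "\<lambda>c. c"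
  by unfold_locales simp_all

lemma mp_eval_simps:
  "mp_eval (0 :: ('v::finite, 'a::comm_semiring_1) mpoly) x = 0"
  "mp_eval (1 :: ('v::finite, 'a::comm_semiring_1) mpoly) x = 1"
  "mp_eval (mp_const c) x = c"
  "mp_eval (p + q) x = mp_eval p x + mp_eval q x"
  "mp_eval (p * q) x = mp_eval p x * mp_eval q x"
  "mp_eval (p ^ n) x = mp_eval p x ^ n"
  "mp_eval (sum P I) x = (\<Sum>i\<in>I. mp_eval (P i) x)"
  "mp_eval (prod P I) x = (\<Prod>i\<in>I. mp_eval (P i) x)"
  "mp_eval (Poly_Mapping.single m c) x = c * (\<Prod>k\<in>UNIV. x k ^ (m $ k))"
  by (simp_all add: mp_eval_def eval_hom.mp_subst_add eval_hom.mp_subst_mult eval_hom.mp_subst_power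
      eval_hom.mp_subst_sum eval_hom.mp_subst_prod)

lemma mp_eval_diff:
  fixes p q :: "('v::finite, 'a::comm_ring_1) mpoly"
  shows "mp_eval (p - q) x = mp_eval p x - mp_eval q x"
  using mp_eval_simps(4)[of "p - q" q x] by (simp add: algebra_simps)

lemma mp_eval_var [simp]: "mp_eval (mp_var k) x = x k"
proof -
  have "(\<Prod>l\<in>UNIV. x l ^ (axis k 1 $ l)) = (\<Prod>l\<in>UNIV. if l = k then x l else 1)"
    by (rule prod.cong) (auto simp: axis_def)
  then show ?thesis
    by (simp add: mp_var_def mp_eval_simps)
qed

lemma mp_eval_expand:
  "mp_eval p x = (\<Sum>m\<in>Poly_Mapping.keys p. Poly_Mapping.lookup p m * (\<Prod>k\<in>UNIV. x k ^ (m $ k)))"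
  by (simp add: mp_eval_def mp_subst_def)

lemma mp_eval_mp_subst_const:
  fixes x :: "'v::finite \<Rightarrow> ('w::finite, 'a::comm_semiring_1) mpoly"
  shows "mp_eval (mp_subst mp_const x p) y = mp_eval p (\<lambda>k. mp_eval (x k) y)"
  by (simp add: mp_subst_def mp_eval_simps mp_eval_expand[of p])

section \<open>Total degree\<close>

lemma total_degree_le_iff:
  "total_degree p \<le> d \<longleftrightarrow> (\<forall>m\<in>Poly_Mapping.keys p. (\<Sum>k\<in>UNIV. m $ k) \<le> d)"
  by (auto simp: total_degree_def)

lemma total_degree_zero [simp]: "total_degree 0 = 0"
  by (simp add: total_degree_def)

lemma total_degree_const [simp]: "total_degree (mp_const c) = 0"
  by (simp add: total_degree_def mp_const_def)

lemma total_degree_one [simp]: "total_degree 1 = 0"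
  by (simp add: total_degree_def)

lemma total_degree_single_le: "total_degree (Poly_Mapping.single m c) \<le> (\<Sum>k\<in>UNIV. m $ k)"
  by (simp add: total_degree_le_iff)

lemma total_degree_var_le: "total_degree (mp_var k) \<le> 1"
  unfolding mp_var_def by (rule order.trans[OF total_degree_single_le]) (simp add: axis_def)

lemma total_degree_add_le:
  "\<lbrakk>total_degree p \<le> d; total_degree q \<le> d\<rbrakk> \<Longrightarrow> total_degree (p + q) \<le> d"
  using Poly_Mapping.keys_add[of p q] by (fastforce simp: total_degree_le_iff)

lemma total_degree_uminus [simp]:
  fixes p :: "('v::finite, 'a::comm_ring_1) mpoly"
  shows "total_degree (- p) = total_degree p"
  by (simp add: total_degree_def Poly_Mapping.keys.rep_eq)

lemma total_degree_diff_le: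
  fixes p q :: "('v::finite, 'a::comm_ring_1) mpoly"
  shows "\<lbrakk>total_degree p \<le> d; total_degree q \<le> d\<rbrakk> \<Longrightarrow> total_degree (p - q) \<le> d"
  using total_degree_add_le[of p d "- q"] by simp

lemma total_degree_sum_le:
  "(\<And>i. i \<in> I \<Longrightarrow> total_degree (p i) \<le> d) \<Longrightarrow> total_degree (sum p I) \<le> d"
  by (induction I rule: infinite_finite_induct) (auto intro: total_degree_add_le)

lemma total_degree_mult_le: "total_degree (p * q) \<le> total_degree p + total_degree q"
  unfolding total_degree_le_iff
proof
  fix m assume "m \<in> Poly_Mapping.keys (p * q)"
  then obtain a b where "a \<in> Poly_Mapping.keys p" "b \<in> Poly_Mapping.keys q" "m = a + b"
    using Poly_Mapping.keys_mult[of p q] by auto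
  then show "(\<Sum>k\<in>UNIV. m $ k) \<le> total_degree p + total_degree q"
    using total_degree_le_iff[of p "total_degree p"] total_degree_le_iff[of q "total_degree q"]
    by (auto simp: sum.distrib intro!: add_mono)
qed

lemma total_degree_const_mult_le: "total_degree (mp_const c * p) \<le> total_degree p"
  using total_degree_mult_le[of "mp_const c" p] by simp

lemma total_degree_power_le: "total_degree (p ^ n) \<le> n * total_degree p"
proof (induction n)
  case (Suc n)
  show ?case using total_degree_mult_le[of p "p ^ n"] Suc by simp
qed simp

lemma total_degree_prod_le: "total_degree (prod p I) \<le> (\<Sum>i\<in>I. total_degree (p i))"
proof (induction I rule: infinite_finite_induct)
  case (insert i I)
  show ?case using total_degree_mult_le[of "p i" "prod p I"] insert by simp
qed simp_all

text \<open>A monomial becomes a product of as many polynomials of degree at most 1 as its degree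
  says. This covers both \<open>split_vars\<close> and \<open>rescale\<close>.\<close>

lemma total_degree_mp_subst_const_le:
  assumes "\<And>k. total_degree (x k) \<le> 1"
  shows "total_degree (mp_subst mp_const x p) \<le> total_degree p"
  unfolding mp_subst_def
proof (rule total_degree_sum_le)
  fix m assume m: "m \<in> Poly_Mapping.keys p"
  have "total_degree (x k ^ (m $ k)) \<le> m $ k" for k
    using total_degree_power_le[of "x k" "m $ k"] assms[of k]
    by (metis mult_le_mono2 mult.right_neutral order.trans)
  then have "total_degree (\<Prod>k\<in>UNIV. x k ^ (m $ k)) \<le> (\<Sum>k\<in>UNIV. m $ k)"
    by (intro order.trans[OF total_degree_prod_le] sum_mono)
  also have "\<dots> \<le> total_degree p"
    using m total_degree_le_iff[of p "total_degree p"] by auto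
  finally show "total_degree (mp_const (Poly_Mapping.lookup p m) * (\<Prod>k\<in>UNIV. x k ^ (m $ k)))
      \<le> total_degree p"
    using total_degree_const_mult_le order.trans by blast
qed

section \<open>Real and imaginary parts\<close>

lemma lookup_map_zero:
  "\<phi> 0 = 0 \<Longrightarrow> Poly_Mapping.lookup (Poly_Mapping.map \<phi> p) m = \<phi> (Poly_Mapping.lookup p m)"
  by (simp add: Poly_Mapping.map.rep_eq when_def)

lemma split_vars_add: "split_vars (p + q) = split_vars p + split_vars q"
  by (simp add: split_vars_def const_hom.mp_subst_add)

lemma re_part_add: "re_part (p + q) = re_part p + re_part q"
  by (rule poly_mapping_eqI) (simp add: re_part_def lookup_map_zero split_vars_add lookup_add)

lemma im_part_add: "im_part (p + q) = im_part p + im_part q"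
  by (rule poly_mapping_eqI) (simp add: im_part_def lookup_map_zero split_vars_add lookup_add)

lemma re_part_zero [simp]: "re_part 0 = 0" and im_part_zero [simp]: "im_part 0 = 0"
  using re_part_add[of 0 0] im_part_add[of 0 0] by simp_all

lemma re_part_uminus: "re_part (- p) = - re_part p"
  using re_part_add[of p "- p"] by (simp add: eq_neg_iff_add_eq_0 add.commute)

lemma im_part_uminus: "im_part (- p) = - im_part p"
  using im_part_add[of p "- p"] by (simp add: eq_neg_iff_add_eq_0 add.commute)

lemma re_part_sum: "re_part (sum p I) = (\<Sum>i\<in>I. re_part (p i))"
  by (induction I rule: infinite_finite_induct) (auto simp: re_part_add)

lemma im_part_sum: "im_part (sum p I) = (\<Sum>i\<in>I. im_part (p i))"
  by (induction I rule: infinite_finite_induct) (auto simp: im_part_add)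

lemma total_degree_map_le:
  "\<phi> 0 = 0 \<Longrightarrow> total_degree (Poly_Mapping.map \<phi> p) \<le> total_degree p"
  using total_degree_le_iff[of p "total_degree p"]
  by (fastforce simp: total_degree_le_iff[of "Poly_Mapping.map \<phi> p"] in_keys_iff lookup_map_zero)

lemma total_degree_split_vars_le: "total_degree (split_vars p) \<le> total_degree p"
  unfolding split_vars_def
  by (intro total_degree_mp_subst_const_le total_degree_add_le
      order.trans[OF total_degree_const_mult_le] total_degree_var_le)

lemma total_degree_re_part_le: "total_degree (re_part p) \<le> total_degree p"
  unfolding re_part_def
  by (rule order.trans[OF total_degree_map_le total_degree_split_vars_le]) simp

lemma total_degree_im_part_le: "total_degree (im_part p) \<le> total_degree p"
  unfolding im_part_def
  by (rule order.trans[OF total_degree_map_le total_degree_split_vars_le]) simp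

text \<open>\<open>Re\<close> and \<open>Im\<close> are not multiplicative, so they are no
  coefficient homomorphisms. At real points the monomials take real values, and real linearity is
  enough to pull the map out of the sum.\<close>

lemma mp_eval_map:
  assumes "\<phi> 0 = 0" "\<And>a b. \<phi> (a + b) = \<phi> a + \<phi> b" "\<And>a c. \<phi> (a * of_real c) = \<phi> a * c"
  shows "mp_eval (Poly_Mapping.map \<phi> p) x = \<phi> (mp_eval p (\<lambda>k. complex_of_real (x k)))"
proof -
  have sum: "\<phi> (sum F I) = (\<Sum>i\<in>I. \<phi> (F i))" for F :: "'b \<Rightarrow> complex" and I
    by (induction I rule: infinite_finite_induct) (auto simp: assms(1,2))
  have "mp_eval (Poly_Mapping.map \<phi> p) x =
      (\<Sum>m\<in>Poly_Mapping.keys p. \<phi> (Poly_Mapping.lookup p m) * (\<Prod>k\<in>UNIV. x k ^ (m $ k)))"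
    unfolding mp_eval_def
    by (subst eval_hom.mp_subst_superset[of "Poly_Mapping.keys p"])
       (auto simp: in_keys_iff lookup_map_zero assms(1))
  then show ?thesis
    by (simp add: mp_eval_expand sum flip: of_real_power of_real_prod assms(3))
qed

lemma mp_eval_split_vars:
  "mp_eval (split_vars p) (\<lambda>k. complex_of_real (case_sum x y k)) = mp_eval p (\<lambda>k. Complex (x k) (y k))"
  by (simp add: split_vars_def mp_eval_mp_subst_const mp_eval_simps Complex_eq)

lemma mp_eval_re_part: "mp_eval (re_part p) (case_sum x y) = Re (mp_eval p (\<lambda>k. Complex (x k) (y k)))"
  unfolding re_part_def by (subst mp_eval_map) (simp_all add: mp_eval_split_vars)

lemma mp_eval_im_part: "mp_eval (im_part p) (case_sum x y) = Im (mp_eval p (\<lambda>k. Complex (x k) (y k)))"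
  unfolding im_part_def by (subst mp_eval_map) (simp_all add: mp_eval_split_vars)

section \<open>Rescaling\<close>

lemma rescale_single:
  fixes c :: "'v::finite \<Rightarrow> 'a::comm_semiring_1"
  shows "rescale c (Poly_Mapping.single m a) = Poly_Mapping.single m (a * (\<Prod>k\<in>UNIV. c k ^ (m $ k)))"
proof -
  have pow: "Poly_Mapping.single l a ^ n = Poly_Mapping.single (\<chi> i. n * l $ i) (a ^ n)"
    for l :: "nat ^ 'v" and a :: 'a and n
  proof (induction n)
    case 0
    have "(\<chi> i. 0 * l $ i) = (0 :: nat ^ 'v)" by (simp add: vec_eq_iff)
    then show ?case by simp
  next
    case (Suc n)
    have "l + (\<chi> i. n * l $ i) = (\<chi> i. Suc n * l $ i)" by (simp add: vec_eq_iff)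
    with Suc show ?case by (simp add: mult_single)
  qed
  have prod: "(\<Prod>k\<in>I. Poly_Mapping.single (L k) (A k)) = Poly_Mapping.single (sum L I) (prod A I)"
    for L :: "'v \<Rightarrow> nat ^ 'v" and A :: "'v \<Rightarrow> 'a" and I
    by (induction I rule: infinite_finite_induct) (auto simp: mult_single)
  \<comment> \<open>Recombines an exponent vector from its multiples of the coordinate vectors,
    which is what the powers of the single variables produce.\<close>
  have m: "(\<Sum>k\<in>UNIV. \<chi> i. m $ k * axis k 1 $ i) = m"
    by (simp add: vec_eq_iff axis_def if_distrib cong: if_cong)
  have "mp_const (c k) * mp_var k = Poly_Mapping.single (axis k 1) (c k)" for k
    by (simp add: mp_const_def mp_var_def mult_single)
  then show ?thesis
    by (simp add: rescale_def pow prod m del: One_nat_def) (simp add: mp_const_def mult_single)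
qed

lemma rescale_sum: "rescale c (sum p I) = (\<Sum>i\<in>I. rescale c (p i))"
  by (simp add: rescale_def const_hom.mp_subst_sum)

lemma rescale_prod: "rescale c (prod p I) = (\<Prod>i\<in>I. rescale c (p i))"
  by (simp add: rescale_def const_hom.mp_subst_prod)

text \<open>Rescaling keeps every exponent and only changes coefficients, so identities between
  rescaled polynomials can be checked coefficientwise.\<close>

lemma lookup_rescale:
  "Poly_Mapping.lookup (rescale c p) m = Poly_Mapping.lookup p m * (\<Prod>k\<in>UNIV. c k ^ (m $ k))"
  by (subst poly_mapping_eq_sum_single[of p])
     (auto simp: rescale_sum rescale_single lookup_sum lookup_single when_def sum.delta in_keys_iff
       if_distrib cong: if_cong)

lemma rescale_rescale: "rescale c (rescale d p) = rescale (\<lambda>k. c k * d k) p"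
  by (rule poly_mapping_eqI) (simp add: lookup_rescale power_mult_distrib prod.distrib mult_ac)

lemma mp_eval_rescale: "mp_eval (rescale c p) x = mp_eval p (\<lambda>k. c k * x k)"
  by (simp add: rescale_def mp_eval_mp_subst_const mp_eval_simps)

lemma total_degree_rescale_le: "total_degree (rescale c p) \<le> total_degree p"
  unfolding rescale_def
  by (intro total_degree_mp_subst_const_le order.trans[OF total_degree_const_mult_le] total_degree_var_le)

section \<open>Lopsidedness certificates\<close>

lemma sum_list_upt_eq_sum: "(\<Sum>i\<leftarrow>[a..<b]. f i) = sum f {a..<b}"
  by (simp add: sum_list_distinct_conv_sum_set)

text \<open>Induction on \<open>e\<close>: the pairs whose larger index is \<open>Suc e\<close>
  contribute exactly the mixed terms by which the right-hand side grows. Indices start at 2 because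
  1 is reserved for the dominating term.\<close>

lemma weighted_variance_identity:
  fixes a x :: "nat \<Rightarrow> 'a::comm_ring_1"
  shows "(\<Sum>(i, j)\<in>{(i, j). 2 \<le> i \<and> i < j \<and> j \<le> e}. a i * a j * (x i - x j)\<^sup>2) =
    (\<Sum>i=2..e. a i) * (\<Sum>i=2..e. a i * (x i)\<^sup>2) - (\<Sum>i=2..e. a i * x i)\<^sup>2"
proof (induction e)
  case 0
  have *: "{(i, j). 2 \<le> i \<and> i < j \<and> j \<le> (0::nat)} = {}" by auto
  show ?case unfolding * by simp
next
  case (Suc e)
  show ?case
  proof (cases "e \<ge> 1")
    \<comment> \<open>Here \<open>e = 0\<close>, so the range from 2 to \<open>Suc e\<close> is
      still empty and both sides vanish.\<close>
    case False
    then have *: "{(i, j). 2 \<le> i \<and> i < j \<and> j \<le> Suc e} = {}" by auto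
    show ?thesis unfolding * using False by simp
  next
    case True
    have split: "{(i, j). 2 \<le> i \<and> i < j \<and> j \<le> Suc e} =
        {(i, j). 2 \<le> i \<and> i < j \<and> j \<le> e} \<union> (\<lambda>i. (i, Suc e)) ` {2..e}"
      by auto
    have fin: "finite {(i, j). 2 \<le> i \<and> i < j \<and> j \<le> e}"
      by (rule finite_subset[of _ "{2..e} \<times> {2..e}"]) auto
    have new: "(\<Sum>i=2..e. a i * a (Suc e) * (x i - x (Suc e))\<^sup>2) =
        a (Suc e) * (\<Sum>i=2..e. a i * (x i)\<^sup>2) - 2 * a (Suc e) * x (Suc e) * (\<Sum>i=2..e. a i * x i)
          + a (Suc e) * (x (Suc e))\<^sup>2 * (\<Sum>i=2..e. a i)"
      by (simp add: power2_eq_square algebra_simps sum.distrib sum_subtractf sum_distrib_left)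
    have "(\<Sum>(i, j)\<in>{(i, j). 2 \<le> i \<and> i < j \<and> j \<le> Suc e}. a i * a j * (x i - x j)\<^sup>2) =
        (\<Sum>(i, j)\<in>{(i, j). 2 \<le> i \<and> i < j \<and> j \<le> e}. a i * a j * (x i - x j)\<^sup>2)
        + (\<Sum>i=2..e. a i * a (Suc e) * (x i - x (Suc e))\<^sup>2)"
      unfolding split using fin
      by (subst sum.union_disjoint) (auto simp: sum.reindex inj_on_def)
    with True show ?thesis
      unfolding Suc new by (simp add: power2_eq_square algebra_simps)
  qed
qed

text \<open>This is the certificate identity multiplied by \<gamma>, with \<open>a i\<close> in the
  role of the moduli. Each product of a sum and a difference is a difference of squares: one square
  cancels against the first summand, the other against the variance formula. What remains of the
  normalizations, \<open>S * S\<close> and the square of \<open>a 1\<close>, cancels against the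
  last bracket.\<close>

lemma lopsidedness_ring_identity:
  fixes a u v :: "nat \<Rightarrow> 'a::comm_ring_1" and e :: nat
  defines "S \<equiv> \<Sum>i=2..e. a i"
  shows "(a 1)\<^sup>2 * ((u 1)\<^sup>2 + (v 1)\<^sup>2 - 1) - (\<Sum>i=2..e. a i * S * ((u i)\<^sup>2 + (v i)\<^sup>2 - 1))
    + (a 1 * u 1 + (\<Sum>i=2..e. a i * u i)) * (- (a 1 * u 1) + (\<Sum>i=2..e. a i * u i))
    + (a 1 * v 1 + (\<Sum>i=2..e. a i * v i)) * (- (a 1 * v 1) + (\<Sum>i=2..e. a i * v i))
    + (\<Sum>(i, j)\<in>{(i, j). 2 \<le> i \<and> i < j \<and> j \<le> e}. a i * a j * ((u i - u j)\<^sup>2 + (v i - v j)\<^sup>2))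
    + ((a 1)\<^sup>2 - S\<^sup>2) = 0"
proof -
  have pairs: "(\<Sum>(i, j)\<in>{(i, j). 2 \<le> i \<and> i < j \<and> j \<le> e}. a i * a j * ((u i - u j)\<^sup>2 + (v i - v j)\<^sup>2)) =
     (S * (\<Sum>i=2..e. a i * (u i)\<^sup>2) - (\<Sum>i=2..e. a i * u i)\<^sup>2)
     + (S * (\<Sum>i=2..e. a i * (v i)\<^sup>2) - (\<Sum>i=2..e. a i * v i)\<^sup>2)"
    unfolding S_def weighted_variance_identity[symmetric]
    by (simp add: distrib_left sum.distrib case_prod_unfold)
  have norms: "(\<Sum>i=2..e. a i * S * ((u i)\<^sup>2 + (v i)\<^sup>2 - 1)) =
     S * (\<Sum>i=2..e. a i * (u i)\<^sup>2) + S * (\<Sum>i=2..e. a i * (v i)\<^sup>2) - S * S"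
  proof -
    have "(\<Sum>i=2..e. a i * S * ((u i)\<^sup>2 + (v i)\<^sup>2 - 1)) =
      (\<Sum>i=2..e. S * (a i * (u i)\<^sup>2) + S * (a i * (v i)\<^sup>2) - S * a i)"
      by (rule sum.cong) (simp_all add: algebra_simps)
    then show ?thesis
      by (simp only: sum.distrib sum_subtractf flip: sum_distrib_left) (simp add: S_def)
  qed
  show ?thesis
    unfolding pairs norms by (simp add: power2_eq_square algebra_simps)
qed

section \<open>Sums of squares of polynomials\<close>

definition sum_of_squares :: "'a::comm_semiring_1 \<Rightarrow> bool" where
  "sum_of_squares p \<longleftrightarrow> (\<exists>qs. p = (\<Sum>q\<leftarrow>qs. q\<^sup>2))"

lemma sum_of_squares_zero: "sum_of_squares 0"
  unfolding sum_of_squares_def by (rule exI[of _ "[]"]) simp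

lemma sum_of_squares_square: "sum_of_squares (q\<^sup>2)"
  unfolding sum_of_squares_def by (rule exI[of _ "[q]"]) simp

lemma sum_of_squares_add: "sum_of_squares p \<Longrightarrow> sum_of_squares q \<Longrightarrow> sum_of_squares (p + q)"
  unfolding sum_of_squares_def by (metis map_append sum_list_append)

lemma sum_of_squares_sum: "(\<And>i. i \<in> I \<Longrightarrow> sum_of_squares (p i)) \<Longrightarrow> sum_of_squares (sum p I)"
  by (induction I rule: infinite_finite_induct)
     (auto intro: sum_of_squares_zero sum_of_squares_add)

text \<open>A nonnegative real constant is the square of its root, which can be absorbed into each
  squared polynomial.\<close>

lemma sum_of_squares_const_mult:
  fixes p :: "('v::finite, real) mpoly"
  assumes "c \<ge> 0" "sum_of_squares p"
  shows "sum_of_squares (mp_const c * p)"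
proof -
  obtain qs where qs: "p = (\<Sum>q\<leftarrow>qs. q\<^sup>2)"
    using assms(2) by (auto simp: sum_of_squares_def)
  have "mp_const c = (mp_const (sqrt c) :: ('v, real) mpoly)\<^sup>2"
    using assms(1) by (simp flip: mp_const_power)
  then have "mp_const c * p = (\<Sum>q\<leftarrow>map ((*) (mp_const (sqrt c))) qs. q\<^sup>2)"
    by (simp add: qs comp_def power_mult_distrib sum_list_const_mult)
  then show ?thesis
    unfolding sum_of_squares_def by blast
qed

text \<open>Fixes a polynomial with an admissible ordering of its exponents, so that the local names
  inside \<open>lopsidedness_certificate\<close> become constants about which lemmas can be stated;
  \<open>certificate_eq\<close> is the link.\<close>

locale lopsided_poly =
  fixes h :: "('n::finite, complex) mpoly" and \<beta> :: "nat \<Rightarrow> nat ^ 'n"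
  assumes enumeration: "dominating_enumeration h \<beta>"
begin

definition "e = card (Poly_Mapping.keys h)"
definition "c i = Poly_Mapping.lookup h (\<beta> i)"
definition "t i = Poly_Mapping.single (\<beta> i) (c i)"
definition "u i = mp_const (1 / cmod (c i)) * re_part (t i)"
definition "v i = mp_const (1 / cmod (c i)) * im_part (t i)"
definition "S = (\<Sum>i=2..e. cmod (c i))"
definition "\<gamma> = (cmod (c 1))\<^sup>2 - S\<^sup>2"
definition "a = - t 1 + (\<Sum>i=2..e. t i)"
definition "s i = (if i \<le> e then (u i)\<^sup>2 + (v i)\<^sup>2 - 1 else if i = e + 1 then re_part h else im_part h)"
definition "g i = (if i = 1 then mp_const ((cmod (c 1))\<^sup>2 / \<gamma>)
                  else if i \<le> e then mp_const (- cmod (c i) * S / \<gamma>)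
                  else if i = e + 1 then mp_const (1 / \<gamma>) * re_part a
                  else mp_const (1 / \<gamma>) * im_part a)"
definition "H = mp_const (1 / \<gamma>) *
             (\<Sum>(i, j)\<in>{(i, j). 2 \<le> i \<and> i < j \<and> j \<le> e}.
                mp_const (cmod (c i) * cmod (c j)) * ((u i - u j)\<^sup>2 + (v i - v j)\<^sup>2))"

lemma certificate_eq:
  "lopsidedness_certificate h \<beta> = Certificate (map (\<lambda>i. (s i, g i)) [1..<e + 3]) H"
  unfolding lopsidedness_certificate_def Let_def H_def g_def s_def a_def \<gamma>_def S_def v_def u_def
    t_def c_def e_def by simp

lemma bij: "bij_betw \<beta> {1..e} (Poly_Mapping.keys h)"
  using enumeration by (simp add: dominating_enumeration_def e_def)

lemma e_pos: "e \<ge> 1"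
  using enumeration
  by (auto simp: dominating_enumeration_def dominating_def e_def Suc_le_eq card_gt_0_iff)

lemma c_nonzero: "i \<in> {1..e} \<Longrightarrow> c i \<noteq> 0"
  using bij by (auto simp: bij_betw_def c_def in_keys_iff)

lemma sum_from_one:
  fixes F :: "nat \<Rightarrow> 'b::comm_monoid_add"
  shows "(\<Sum>i=1..e. F i) = F 1 + (\<Sum>i=2..e. F i)"
  using e_pos sum.atLeast_Suc_atMost[of 1 e F] by (simp add: numeral_2_eq_2)

lemma poly_eq: "h = t 1 + (\<Sum>i=2..e. t i)"
proof -
  have "h = (\<Sum>i=1..e. t i)"
    by (subst poly_mapping_eq_sum_single) (simp add: sum.reindex_bij_betw[OF bij, symmetric] t_def c_def)
  then show ?thesis by (simp only: sum_from_one)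
qed

text \<open>Deleting the index 1 corresponds under \<beta> to deleting the dominating exponent, and
  at the point 0 the term moduli are just the moduli of the coefficients.\<close>

lemma S_less: "S < cmod (c 1)"
proof -
  have "bij_betw \<beta> ({1..e} - {1}) (Poly_Mapping.keys h - {\<beta> 1})"
    using bij e_pos by (intro bij_betw_subset[OF bij]) (auto simp: bij_betw_def inj_on_image_set_diff[of _ "{1..e}"])
  moreover have "{1..e} - {1} = {2..e}" by auto
  ultimately have "bij_betw \<beta> {2..e} (Poly_Mapping.keys h - {\<beta> 1})" by simp
  from sum.reindex_bij_betw[OF this, of "term_moduli h 0"] show ?thesis
    using enumeration
    by (simp add: dominating_enumeration_def dominating_def S_def c_def term_moduli_def)
qed

lemma \<gamma>_pos: "\<gamma> > 0"
proof -
  have "0 \<le> S" by (simp add: S_def sum_nonneg)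
  then show ?thesis
    unfolding \<gamma>_def using S_less by (simp add: power_strict_mono)
qed

lemma const_mult_u: "i \<in> {1..e} \<Longrightarrow> mp_const (cmod (c i)) * u i = re_part (t i)"
  using c_nonzero[of i] by (simp add: u_def flip: mult.assoc mp_const_mult)

lemma const_mult_v: "i \<in> {1..e} \<Longrightarrow> mp_const (cmod (c i)) * v i = im_part (t i)"
  using c_nonzero[of i] by (simp add: v_def flip: mult.assoc mp_const_mult)

lemma identity: "certificate_identity (lopsidedness_certificate h \<beta>)"
proof -
  \<comment> \<open>The moduli are lifted to constant polynomials, so that the ring identity can be
    instantiated in the polynomial ring itself.\<close>
  define A where "A i = (mp_const (cmod (c i)) :: ('n + 'n, real) mpoly)" for i
  define S' where "S' = (\<Sum>i=2..e. A i)"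
  let ?k = "mp_const (1 / \<gamma>) :: ('n + 'n, real) mpoly"
  have S': "mp_const S = S'"
    by (simp add: S_def S'_def A_def mp_const_sum)
  \<comment> \<open>Rewrites the summand 1 of the certificate as a multiple of \<open>?k\<close>;
    then \<open>?k\<close> factors out of the whole expression.\<close>
  have k: "?k * ((A 1)\<^sup>2 - S'\<^sup>2) = 1"
    using \<gamma>_pos
    by (simp add: A_def \<gamma>_def flip: S' mp_const_power mp_const_diff mp_const_mult)
  have tu: "re_part (t i) = A i * u i" and tv: "im_part (t i) = A i * v i" if "i \<in> {1..e}" for i
    using const_mult_u[OF that] const_mult_v[OF that] by (simp_all add: A_def)
  have sums: "(\<Sum>i=2..e. re_part (t i)) = (\<Sum>i=2..e. A i * u i)"
      "(\<Sum>i=2..e. im_part (t i)) = (\<Sum>i=2..e. A i * v i)"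
    by (auto intro!: sum.cong simp: tu tv)
  have re: "re_part h = A 1 * u 1 + (\<Sum>i=2..e. A i * u i)"
    and im: "im_part h = A 1 * v 1 + (\<Sum>i=2..e. A i * v i)"
    using e_pos by (subst poly_eq, simp only: re_part_add re_part_sum im_part_add im_part_sum sums, simp add: tu tv)+
  have re': "re_part a = - (A 1 * u 1) + (\<Sum>i=2..e. A i * u i)"
    and im': "im_part a = - (A 1 * v 1) + (\<Sum>i=2..e. A i * v i)"
    using e_pos unfolding a_def
    by (simp_all only: re_part_add re_part_sum re_part_uminus im_part_add im_part_sum im_part_uminus sums)
       (simp_all add: tu tv)
  have g1: "g 1 = ?k * (A 1)\<^sup>2"
    by (simp add: g_def A_def flip: mp_const_power mp_const_mult)
  have gi: "g i = - (?k * (A i * S'))" if "i \<in> {2..e}" for i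
    using that by (simp add: g_def A_def flip: S' mp_const_mult mp_const_uminus)
  let ?N = "\<Sum>i=2..e. A i * S' * ((u i)\<^sup>2 + (v i)\<^sup>2 - 1)"
  \<comment> \<open>Besides the \<open>e\<close> normalizations there are two further summands, for
    the real and the imaginary part of \<open>h\<close>.\<close>
  have "{1..<e + 3} = insert (e + 2) (insert (e + 1) {1..e})" by auto
  then have "(\<Sum>i\<leftarrow>[1..<e + 3]. s i * g i) =
      s 1 * g 1 + (\<Sum>i=2..e. s i * g i) + s (e + 1) * g (e + 1) + s (e + 2) * g (e + 2)"
    by (simp add: sum_list_upt_eq_sum sum_from_one[unfolded One_nat_def] algebra_simps)
  also have "(\<Sum>i=2..e. s i * g i) = - (?k * (\<Sum>i=2..e. A i * S' * ((u i)\<^sup>2 + (v i)\<^sup>2 - 1)))"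
    by (simp add: s_def gi sum_distrib_left mult_ac flip: sum_negf)
  also have "s 1 * g 1 = ?k * ((A 1)\<^sup>2 * ((u 1)\<^sup>2 + (v 1)\<^sup>2 - 1))"
    using e_pos unfolding g1 by (simp add: s_def mult_ac)
  also have "s (e + 1) * g (e + 1) = ?k * (re_part h * re_part a)"
    using e_pos by (simp add: s_def g_def mult_ac)
  also have "s (e + 2) * g (e + 2) = ?k * (im_part h * im_part a)"
    using e_pos by (simp add: s_def g_def mult_ac)
  finally have sum: "(\<Sum>i\<leftarrow>[1..<e + 3]. s i * g i) =
      ?k * ((A 1)\<^sup>2 * ((u 1)\<^sup>2 + (v 1)\<^sup>2 - 1)) + - (?k * ?N)
      + ?k * (re_part h * re_part a) + ?k * (im_part h * im_part a)" .
  have H: "H = ?k * (\<Sum>(i, j)\<in>{(i, j). 2 \<le> i \<and> i < j \<and> j \<le> e}.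
      A i * A j * ((u i - u j)\<^sup>2 + (v i - v j)\<^sup>2))"
    by (simp add: H_def A_def mp_const_mult)
  let ?P = "\<Sum>(i, j)\<in>{(i, j). 2 \<le> i \<and> i < j \<and> j \<le> e}. A i * A j * ((u i - u j)\<^sup>2 + (v i - v j)\<^sup>2)"
  have "(\<Sum>i\<leftarrow>[1..<e + 3]. s i * g i) + H + 1 =
      ?k * ((A 1)\<^sup>2 * ((u 1)\<^sup>2 + (v 1)\<^sup>2 - 1) - ?N + re_part h * re_part a + im_part h * im_part a
        + ?P + ((A 1)\<^sup>2 - S'\<^sup>2))"
    unfolding sum H distrib_left right_diff_distrib k[unfolded right_diff_distrib] by (simp add: algebra_simps)
  also have "\<dots> = 0"
    unfolding re im re' im' using lopsidedness_ring_identity[of A u v e] by (simp add: S'_def)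
  finally have "(\<Sum>i\<leftarrow>[1..<e + 3]. s i * g i) + H + 1 = 0" .
  then show ?thesis
    by (simp add: certificate_identity_def certificate_eq comp_def)
qed

lemma sum_of_squares_H: "sum_of_squares H"
  unfolding H_def using \<gamma>_pos
  by (intro sum_of_squares_const_mult sum_of_squares_sum)
     (auto intro!: sum_of_squares_const_mult sum_of_squares_add sum_of_squares_square)

lemma mp_eval_u: "mp_eval (u i) (case_sum x y) = Re (mp_eval (t i) (\<lambda>k. Complex (x k) (y k))) / cmod (c i)"
  and mp_eval_v: "mp_eval (v i) (case_sum x y) = Im (mp_eval (t i) (\<lambda>k. Complex (x k) (y k))) / cmod (c i)"
  by (simp_all add: u_def v_def mp_eval_simps mp_eval_re_part mp_eval_im_part)

text \<open>Dividing by the modulus of the coefficient removes every trace of it, so the summand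
  depends on the exponent alone. Hence it vanishes on the unit torus, and the exponent can be
  recovered from it.\<close>

lemma mp_eval_norm_summand:
  assumes "i \<in> {1..e}"
  shows "mp_eval ((u i)\<^sup>2 + (v i)\<^sup>2 - 1) (case_sum x y) =
    (\<Prod>k\<in>UNIV. cmod (Complex (x k) (y k)) ^ (\<beta> i $ k))\<^sup>2 - 1"
proof -
  let ?w = "mp_eval (t i) (\<lambda>k. Complex (x k) (y k))"
  have "mp_eval ((u i)\<^sup>2 + (v i)\<^sup>2 - 1) (case_sum x y) = (cmod ?w / cmod (c i))\<^sup>2 - 1"
    by (simp add: mp_eval_simps mp_eval_diff mp_eval_u mp_eval_v cmod_power2 power_divide
        add_divide_distrib)
  also have "cmod ?w / cmod (c i) = (\<Prod>k\<in>UNIV. cmod (Complex (x k) (y k)) ^ (\<beta> i $ k))"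
    using c_nonzero[OF assms] by (simp add: t_def mp_eval_simps norm_mult norm_power flip: prod_norm)
  finally show ?thesis .
qed

lemma summand_vanishes:
  assumes "\<And>k. cmod (z $ k) = 1" "mp_eval h (($) z) = 0" "i \<ge> 1"
  shows "mp_eval (s i) (case_sum (\<lambda>k. Re (z $ k)) (\<lambda>k. Im (z $ k))) = 0"
  using assms by (auto simp: s_def mp_eval_norm_summand mp_eval_re_part mp_eval_im_part)

text \<open>The test point has j-th coordinate 2 and all others 1, which isolates one component of
  the dominating exponent. As powers of 4 are distinct, the values for all \<open>j\<close>
  determine that exponent from the certificate.\<close>

lemma first_summand:
  "mp_eval (fst (hd (summands (lopsidedness_certificate h \<beta>))))
     (case_sum (\<lambda>k. if k = j then 2 else 1) (\<lambda>_. 0)) = 4 ^ (\<beta> 1 $ j) - 1"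
proof -
  have "(\<Prod>k\<in>UNIV. cmod (Complex (if k = j then 2 else 1) 0) ^ (\<beta> 1 $ k)) =
      (\<Prod>k\<in>UNIV. if k = j then 2 ^ (\<beta> 1 $ k) else 1)"
    by (rule prod.cong) (auto simp: cmod_def)
  then have *: "(\<Prod>k\<in>UNIV. cmod (Complex (if k = j then 2 else 1) 0) ^ (\<beta> 1 $ k)) = 2 ^ (\<beta> 1 $ j)"
    by simp
  have "fst (hd (summands (lopsidedness_certificate h \<beta>))) = s 1"
    by (simp add: certificate_eq upt_conv_Cons)
  also have "s 1 = (u 1)\<^sup>2 + (v 1)\<^sup>2 - 1"
    using e_pos by (simp add: s_def)
  finally have first: "fst (hd (summands (lopsidedness_certificate h \<beta>))) = (u 1)\<^sup>2 + (v 1)\<^sup>2 - 1" .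
  have four: "((2::real) ^ n)\<^sup>2 = 4 ^ n" for n
    by (simp add: power2_eq_square flip: power_mult_distrib)
  show ?thesis
    unfolding first using e_pos by (subst mp_eval_norm_summand) (simp_all only: * four, simp)
qed

section \<open>Degree of the certificate\<close>

lemma degree_single: "i \<in> {1..e} \<Longrightarrow> total_degree (t i) \<le> total_degree h"
  unfolding t_def using bij total_degree_le_iff[of h "total_degree h"]
  by (intro order.trans[OF total_degree_single_le]) (auto simp: bij_betw_def)

lemma degree_u: "i \<in> {1..e} \<Longrightarrow> total_degree (u i) \<le> total_degree h"
  unfolding u_def
  by (meson degree_single order.trans total_degree_const_mult_le total_degree_re_part_le)

lemma degree_v: "i \<in> {1..e} \<Longrightarrow> total_degree (v i) \<le> total_degree h"
  unfolding v_def
  by (meson degree_single order.trans total_degree_const_mult_le total_degree_im_part_le)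

text \<open>For indices up to \<open>e\<close> the cofactor is constant and the other factor is
  quadratic in \<open>u\<close> and \<open>v\<close>; the last two summands multiply two polynomials
  of degree at most that of \<open>h\<close>. \<open>H\<close> is again quadratic in
  \<open>u\<close> and \<open>v\<close>.\<close>

lemma degree: "certificate_degree (lopsidedness_certificate h \<beta>) \<le> 2 * total_degree h"
proof -
  let ?d = "total_degree h"
  have square: "total_degree (p\<^sup>2) \<le> 2 * ?d" if "total_degree p \<le> ?d" for p :: "('n + 'n, real) mpoly"
    using total_degree_power_le[of p 2] that by simp
  have mult: "total_degree (p * q) \<le> 2 * ?d" if "total_degree p \<le> ?d" "total_degree q \<le> ?d"
    for p q :: "('n + 'n, real) mpoly"
    using total_degree_mult_le[of p q] that by simp
  have a: "total_degree a \<le> ?d"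
    unfolding a_def using e_pos by (intro total_degree_add_le total_degree_sum_le) (auto simp: degree_single)
  have "total_degree H \<le> 2 * ?d"
    unfolding H_def
    by (intro order.trans[OF total_degree_const_mult_le] total_degree_sum_le)
       (auto intro!: order.trans[OF total_degree_const_mult_le] total_degree_add_le square
          total_degree_diff_le degree_u degree_v)
  moreover have "total_degree (s i * g i) \<le> 2 * ?d" if "i \<in> {1..<e + 3}" for i
  proof (cases "i \<le> e")
    case True
    then have "\<exists>b. g i = mp_const b"
      by (cases "i = 1") (auto simp: g_def)
    then obtain b where b: "g i = mp_const b" by blast
    show ?thesis
      unfolding b mult.commute[of "s i"] using True that
      by (intro order.trans[OF total_degree_const_mult_le])
         (auto simp: s_def intro!: total_degree_diff_le total_degree_add_le square degree_u degree_v)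
  next
    case False
    then show ?thesis
      using e_pos a unfolding s_def g_def
      by (auto intro!: mult total_degree_re_part_le total_degree_im_part_le
          order.trans[OF total_degree_const_mult_le]
          intro: order.trans[OF total_degree_re_part_le] order.trans[OF total_degree_im_part_le])
  qed
  ultimately show ?thesis
    by (auto simp: certificate_degree_def certificate_eq)
qed

end

section \<open>Winding numbers of periodic functions along a coordinate direction\<close>

text \<open>The winding number is encoded by a continuous logarithm on the space of angles, the
  universal cover of the torus: it is the increment over one period in direction \<open>j\<close>,
  in units of \<open>2 * pi * \<i>\<close>. Such a logarithm forces \<open>F\<close> to be zero-free
  and periodic in that direction.\<close>

definition winds :: "(real ^ 'n::finite \<Rightarrow> complex) \<Rightarrow> 'n \<Rightarrow> int \<Rightarrow> bool" where
  "winds F j \<nu> \<longleftrightarrow> (\<exists>L. continuous_on UNIV L \<and> (\<forall>\<theta>. F \<theta> = exp (L \<theta>)) \<and>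
     (\<forall>\<theta>. L (\<theta> + axis j (2 * pi)) = L \<theta> + 2 * of_real pi * \<i> * of_int \<nu>))"

text \<open>The values lie in a set whose points are at least \<open>2 * pi\<close> apart, and the
  domain is connected.\<close>

lemma continuous_int_valued_constant:
  fixes D :: "'a::real_normed_vector \<Rightarrow> complex"
  assumes "continuous_on UNIV D" "\<And>x. exp (D x) = 1"
  obtains \<nu> :: int where "\<And>x. D x = 2 * of_real pi * \<i> * of_int \<nu>"
proof -
  have ex: "\<exists>n::int. D x = 2 * of_real pi * \<i> * of_int n" for x
    using assms(2)[of x, unfolded exp_eq_1] by (auto simp: complex_eq_iff)
  have "2 * pi \<le> norm (D y - D x)" if neq: "D y \<noteq> D x" for x y
  proof -
    obtain m n :: int where mn: "D x = 2 * of_real pi * \<i> * of_int m" "D y = 2 * of_real pi * \<i> * of_int n"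
      using ex by meson
    then have "1 \<le> \<bar>real_of_int (n - m)\<bar>"
      using neq by (cases "n = m") (auto simp: abs_if)
    have "D y - D x = 2 * of_real pi * \<i> * of_int (n - m)"
      by (simp add: mn algebra_simps)
    then have "norm (D y - D x) = 2 * pi * \<bar>real_of_int (n - m)\<bar>"
      by (simp add: norm_mult del: of_int_diff)
    then show ?thesis
      using \<open>1 \<le> _\<close> by (simp del: of_int_diff)
  qed
  then have "D constant_on UNIV"
    by (intro continuous_discrete_range_constant assms(1) connected_UNIV exI[of _ "2 * pi"]) auto
  then obtain c where "\<And>x. D x = c" by (auto simp: constant_on_def)
  with ex[of undefined] show ?thesis using that by metis
qed

text \<open>A zero-free function on a contractible space has a continuous logarithm; by periodicity
  its increment over a period lies in the discrete kernel of the exponential and so is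
  constant.\<close>

lemma winds_exists:
  fixes F :: "real ^ 'n::finite \<Rightarrow> complex"
  assumes "continuous_on UNIV F" "\<And>\<theta>. F \<theta> \<noteq> 0" "\<And>\<theta>. F (\<theta> + axis j (2 * pi)) = F \<theta>"
  obtains \<nu> where "winds F j \<nu>"
proof -
  obtain L where L: "continuous_on UNIV L" "\<And>\<theta>. F \<theta> = exp (L \<theta>)"
    using continuous_logarithm_on_contractible[OF assms(1) convex_imp_contractible[OF convex_UNIV]]
      assms(2) by (metis UNIV_I)
  have "continuous_on UNIV (\<lambda>\<theta>. L (\<theta> + axis j (2 * pi)) - L \<theta>)"
    by (intro continuous_intros continuous_on_compose2[OF L(1)]) auto
  moreover have "exp (L (\<theta> + axis j (2 * pi)) - L \<theta>) = 1" for \<theta>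
    using assms(3)[of \<theta>] by (simp add: exp_diff L(2))
  ultimately obtain \<nu> :: int where "\<And>\<theta>. L (\<theta> + axis j (2 * pi)) - L \<theta> = 2 * of_real pi * \<i> * of_int \<nu>"
    using continuous_int_valued_constant by blast
  with L have "winds F j \<nu>"
    unfolding winds_def by (intro exI[of _ L]) (simp add: diff_eq_eq add.commute)
  then show ?thesis by (rule that)
qed

text \<open>Two continuous logarithms of the same function differ by a constant, hence have equal
  increments.\<close>

lemma winds_unique:
  assumes "winds F j \<mu>" "winds F j \<nu>"
  shows "\<mu> = \<nu>"
proof -
  obtain L where L: "continuous_on UNIV L" "\<And>\<theta>. F \<theta> = exp (L \<theta>)"
      "\<And>\<theta>. L (\<theta> + axis j (2 * pi)) = L \<theta> + 2 * of_real pi * \<i> * of_int \<mu>"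
    using assms(1) by (auto simp: winds_def)
  obtain M where M: "continuous_on UNIV M" "\<And>\<theta>. F \<theta> = exp (M \<theta>)"
      "\<And>\<theta>. M (\<theta> + axis j (2 * pi)) = M \<theta> + 2 * of_real pi * \<i> * of_int \<nu>"
    using assms(2) by (auto simp: winds_def)
  have "exp (L \<theta> - M \<theta>) = 1" for \<theta>
    using L(2)[of \<theta>] M(2)[of \<theta>] by (simp add: exp_diff)
  then obtain n :: int where "\<And>\<theta>. L \<theta> - M \<theta> = 2 * of_real pi * \<i> * of_int n"
    using continuous_int_valued_constant[of "\<lambda>\<theta>. L \<theta> - M \<theta>"] L(1) M(1) continuous_on_diff by blast
  then have "L (0 + axis j (2 * pi)) - M (0 + axis j (2 * pi)) = L 0 - M 0" by simp
  then show ?thesis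
    unfolding L(3) M(3) by simp
qed

lemma winds_one: "winds (\<lambda>_. 1) j 0"
  unfolding winds_def by (rule exI[of _ "\<lambda>_. 0"]) simp

lemma winds_mult:
  assumes "winds F j \<mu>" "winds G j \<nu>"
  shows "winds (\<lambda>\<theta>. F \<theta> * G \<theta>) j (\<mu> + \<nu>)"
proof -
  obtain L where L: "continuous_on UNIV L" "\<And>\<theta>. F \<theta> = exp (L \<theta>)"
      "\<And>\<theta>. L (\<theta> + axis j (2 * pi)) = L \<theta> + 2 * of_real pi * \<i> * of_int \<mu>"
    using assms(1) by (auto simp: winds_def)
  obtain M where M: "continuous_on UNIV M" "\<And>\<theta>. G \<theta> = exp (M \<theta>)"
      "\<And>\<theta>. M (\<theta> + axis j (2 * pi)) = M \<theta> + 2 * of_real pi * \<i> * of_int \<nu>"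
    using assms(2) by (auto simp: winds_def)
  show ?thesis
    unfolding winds_def using L M
    by (intro exI[of _ "\<lambda>\<theta>. L \<theta> + M \<theta>"])
       (auto simp: exp_add algebra_simps intro!: continuous_intros)
qed

lemma winds_prod:
  "(\<And>i. i \<in> I \<Longrightarrow> winds (F i) j \<nu>) \<Longrightarrow> winds (\<lambda>\<theta>. \<Prod>i\<in>I. F i \<theta>) j (int (card I) * \<nu>)"
proof (induction I rule: infinite_finite_induct)
  case (insert i I)
  then show ?case
    using winds_mult[of "F i" j \<nu> "\<lambda>\<theta>. \<Prod>i\<in>I. F i \<theta>" "int (card I) * \<nu>"]
    by (simp add: algebra_simps)
qed (simp_all add: winds_one)

lemma winds_translate:
  assumes "winds F j \<nu>"
  shows "winds (\<lambda>\<theta>. F (\<theta> + \<tau>)) j \<nu>"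
proof -
  obtain L where L: "continuous_on UNIV L" "\<And>\<theta>. F \<theta> = exp (L \<theta>)"
      "\<And>\<theta>. L (\<theta> + axis j (2 * pi)) = L \<theta> + 2 * of_real pi * \<i> * of_int \<nu>"
    using assms by (auto simp: winds_def)
  have "L (\<theta> + axis j (2 * pi) + \<tau>) = L (\<theta> + \<tau>) + 2 * of_real pi * \<i> * of_int \<nu>" for \<theta>
    using L(3)[of "\<theta> + \<tau>"] by (simp add: add_ac)
  then show ?thesis
    unfolding winds_def using L(2)
    by (intro exI[of _ "\<lambda>\<theta>. L (\<theta> + \<tau>)"])
       (auto intro!: continuous_intros continuous_on_compose2[OF L(1)])
qed

text \<open>The quotient of \<open>E\<close> by \<open>F\<close> stays within distance less than 1
  of 1, away from the branch cut. Its principal logarithm is therefore continuous and periodic, and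
  adding it to a logarithm of \<open>F\<close> leaves the increment unchanged.\<close>

lemma winds_Rouche:
  assumes "winds F j \<nu>" "continuous_on UNIV E" "\<And>\<theta>. E (\<theta> + axis j (2 * pi)) = E \<theta>"
    and less: "\<And>\<theta>. cmod (E \<theta> - F \<theta>) < cmod (F \<theta>)"
  shows "winds E j \<nu>"
proof -
  obtain L where L: "continuous_on UNIV L" "\<And>\<theta>. F \<theta> = exp (L \<theta>)"
      "\<And>\<theta>. L (\<theta> + axis j (2 * pi)) = L \<theta> + 2 * of_real pi * \<i> * of_int \<nu>"
    using assms(1) by (auto simp: winds_def)
  have F: "continuous_on UNIV F" "F \<theta> \<noteq> 0" for \<theta>
    using L(1) by (auto simp: L(2) intro: continuous_intros)
  have per: "F (\<theta> + axis j (2 * pi)) = F \<theta>" for \<theta>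
    by (simp add: L(2,3) exp_add exp_eq_1)
  have quotient: "0 < Re (E \<theta> / F \<theta>)" for \<theta>
  proof -
    have "E \<theta> / F \<theta> - 1 = (E \<theta> - F \<theta>) / F \<theta>"
      using F(2)[of \<theta>] by (simp add: diff_divide_distrib)
    then have "cmod (E \<theta> / F \<theta> - 1) < 1"
      using less[of \<theta>] F(2)[of \<theta>] by (simp add: norm_divide)
    then have "\<bar>Re (E \<theta> / F \<theta> - 1)\<bar> < 1"
      using abs_Re_le_cmod order.strict_trans1 by blast
    then show ?thesis by simp
  qed
  then have "E \<theta> / F \<theta> \<notin> \<real>\<^sub>\<le>\<^sub>0" for \<theta>
    by (metis complex_nonpos_Reals_iff not_le)
  then have "continuous_on UNIV (\<lambda>\<theta>. L \<theta> + Ln (E \<theta> / F \<theta>))"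
    using F by (intro continuous_intros L(1) assms(2)) auto
  moreover have "E \<theta> = exp (L \<theta> + Ln (E \<theta> / F \<theta>))" for \<theta>
  proof -
    have "E \<theta> / F \<theta> \<noteq> 0"
      using quotient[of \<theta>] by (metis less_irrefl zero_complex.sel(1))
    then show ?thesis
      using F(2)[of \<theta>] by (simp add: exp_add flip: L(2))
  qed
  ultimately show ?thesis
    unfolding winds_def
    by (intro exI[of _ "\<lambda>\<theta>. L \<theta> + Ln (E \<theta> / F \<theta>)"]) (auto simp: L(3) per assms(3))
qed

section \<open>Polynomials on tori\<close>

definition torus_monomial :: "real ^ 'n::finite \<Rightarrow> nat ^ 'n \<Rightarrow> real ^ 'n \<Rightarrow> complex" where
  "torus_monomial w m \<theta> = (\<Prod>k\<in>UNIV. torus_point w \<theta> $ k ^ (m $ k))"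

text \<open>In logarithmic coordinates a monomial is the exponential of a linear form, which makes
  its modulus, its periodicity and a logarithm explicit.\<close>

lemma torus_monomial_exp:
  "torus_monomial w m \<theta> = exp (of_real (exponent_vector m \<bullet> w) + \<i> * of_real (exponent_vector m \<bullet> \<theta>))"
proof -
  have "torus_monomial w m \<theta> = (\<Prod>k\<in>UNIV. exp (of_nat (m $ k) * Complex (w $ k) (\<theta> $ k)))"
    unfolding torus_monomial_def torus_point_def by (simp add: exp_of_nat_mult)
  also have "\<dots> = exp (\<Sum>k\<in>UNIV. of_nat (m $ k) * Complex (w $ k) (\<theta> $ k))"
    by (simp add: exp_sum)
  also have "(\<Sum>k\<in>UNIV. of_nat (m $ k) * Complex (w $ k) (\<theta> $ k)) =
      of_real (exponent_vector m \<bullet> w) + \<i> * of_real (exponent_vector m \<bullet> \<theta>)"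
    by (simp add: complex_eq_iff inner_vec_def exponent_vector_def)
  finally show ?thesis .
qed

lemma norm_torus_monomial: "cmod (torus_monomial w m \<theta>) = exp (exponent_vector m \<bullet> w)"
  by (simp add: torus_monomial_exp)

lemma exponent_vector_inner_axis: "exponent_vector m \<bullet> axis j s = real (m $ j) * s"
  by (simp add: inner_axis exponent_vector_def)

lemma torus_monomial_add_axis:
  "torus_monomial w m (\<theta> + axis j s) = torus_monomial w m \<theta> * exp (\<i> * of_nat (m $ j) * of_real s)"
  unfolding torus_monomial_exp inner_add_right exponent_vector_inner_axis
  by (simp add: exp_add algebra_simps)

lemma exp_int_2pi: "exp (\<i> * of_nat n * of_real (2 * pi)) = 1"
  by (auto simp: exp_eq_1 intro: exI[of _ "int n"])

lemma torus_monomial_periodic: "torus_monomial w m (\<theta> + axis j (2 * pi)) = torus_monomial w m \<theta>"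
  using exp_int_2pi[of "m $ j"] by (simp add: torus_monomial_add_axis)

lemma continuous_on_torus_monomial [continuous_intros]:
  "continuous_on A f \<Longrightarrow> continuous_on A g \<Longrightarrow> continuous_on A (\<lambda>x. torus_monomial (f x) m (g x))"
  unfolding torus_monomial_exp by (intro continuous_intros)

lemma winds_torus_monomial:
  assumes "a \<noteq> 0"
  shows "winds (\<lambda>\<theta>. a * torus_monomial w m \<theta>) j (int (m $ j))"
  unfolding winds_def using assms
  by (intro exI[of _ "\<lambda>\<theta>. Ln a + (of_real (exponent_vector m \<bullet> w) + \<i> * of_real (exponent_vector m \<bullet> \<theta>))"])
     (auto simp: exp_add torus_monomial_exp inner_add_right exponent_vector_inner_axis algebra_simps
       intro!: continuous_intros)

lemma torus_point_nonzero [simp]: "torus_point w \<theta> $ k \<noteq> 0"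
  by (simp add: torus_point_def)

lemma mp_eval_torus:
  "mp_eval p (($) (torus_point w \<theta>)) =
     (\<Sum>m\<in>Poly_Mapping.keys p. Poly_Mapping.lookup p m * torus_monomial w m \<theta>)"
  by (simp add: mp_eval_expand torus_monomial_def)

lemma mp_eval_torus_periodic:
  "mp_eval p (($) (torus_point w (\<theta> + axis j (2 * pi)))) = mp_eval p (($) (torus_point w \<theta>))"
  by (simp add: mp_eval_torus torus_monomial_periodic)

lemma continuous_on_mp_eval_torus [continuous_intros]:
  assumes "continuous_on A f" "continuous_on A g"
  shows "continuous_on A (\<lambda>x. mp_eval p (($) (torus_point (f x) (g x))))"
  unfolding mp_eval_torus by (intro continuous_intros assms)

lemma mem_amoeba_iff: "w \<in> amoeba f \<longleftrightarrow> (\<exists>\<theta>. mp_eval f (($) (torus_point w \<theta>)) = 0)"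
proof
  assume "w \<in> amoeba f"
  then obtain z where z: "w = Log_map z" "\<And>k. z $ k \<noteq> 0" "mp_eval f (($) z) = 0"
    by (auto simp: amoeba_def)
  \<comment> \<open>The angles are the arguments of the coordinates, since \<open>w\<close> already
    carries the logarithms of their moduli.\<close>
  have "torus_point w (\<chi> k. Arg (z $ k)) = z"
  proof -
    have "exp (Complex (ln (cmod (z $ k))) (Arg (z $ k))) = z $ k" for k
      using exp_Ln[OF z(2)[of k]] by (simp add: Ln_Arg[OF z(2)] Complex_eq)
    then show ?thesis
      by (simp add: vec_eq_iff torus_point_def z(1) Log_map_def)
  qed
  with z(3) show "\<exists>\<theta>. mp_eval f (($) (torus_point w \<theta>)) = 0" by metis
next
  assume "\<exists>\<theta>. mp_eval f (($) (torus_point w \<theta>)) = 0"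
  then obtain \<theta> where "mp_eval f (($) (torus_point w \<theta>)) = 0" ..
  moreover have "w = Log_map (torus_point w \<theta>)"
    by (simp add: vec_eq_iff Log_map_def torus_point_def)
  ultimately show "w \<in> amoeba f"
    unfolding amoeba_def using torus_point_nonzero by blast
qed

section \<open>The order as a winding number\<close>

text \<open>Only continuity of \<open>L\<close> is assumed. Near each point it agrees with a branch
  built from the principal logarithm, which yields its derivative; then the fundamental theorem
  applies.\<close>

lemma integral_log_derivative:
  fixes q L :: "real \<Rightarrow> complex"
  assumes deriv: "\<And>s. (q has_vector_derivative q' s) (at s)"
    and L: "continuous_on UNIV L" "\<And>s. q s = exp (L s)" and "a \<le> b"
  shows "((\<lambda>s. q' s / q s) has_integral (L b - L a)) {a..b}"
proof (rule fundamental_theorem_of_calculus)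
  fix s0 :: real
  have nz: "q s0 \<noteq> 0" by (simp add: L(2))
  have "((\<lambda>s. q s / q s0) has_vector_derivative q' s0 / q s0) (at s0)"
    using deriv[of s0] by (intro has_vector_derivative_divide)
  moreover have "(Ln has_field_derivative 1 / (q s0 / q s0)) (at (q s0 / q s0))"
    using nz by (auto intro!: derivative_eq_intros)
  ultimately have "((\<lambda>s. L s0 + Ln (q s / q s0)) has_vector_derivative (0 + q' s0 / q s0)) (at s0)"
    using field_vector_diff_chain_at[of "\<lambda>s. q s / q s0" "q' s0 / q s0" s0 Ln 1] nz
    by (intro has_vector_derivative_add has_vector_derivative_const) (simp add: comp_def)
  note deriv_Ln = this
  \<comment> \<open>By continuity of \<open>L\<close> this is a neighbourhood of \<open>s0\<close>;
    on it the imaginary part of \<open>L\<close> moves by less than \<open>pi\<close>, so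
    \<open>Ln\<close> inverts the exponential there.\<close>
  have "open (L -` ball (L s0) pi)"
    using L(1) open_ball continuous_on_open_vimage[of UNIV L] by auto
  moreover have "L s0 + Ln (q s / q s0) = L s" if "s \<in> L -` ball (L s0) pi" for s
  proof -
    have "\<bar>Im (L s - L s0)\<bar> < pi"
      using that abs_Im_le_cmod[of "L s - L s0"] by (simp add: dist_norm norm_minus_commute)
    then have "Ln (exp (L s - L s0)) = L s - L s0"
      by (intro Ln_exp) auto
    then show ?thesis by (simp add: L(2) exp_diff)
  qed
  ultimately have "(L has_vector_derivative (0 + q' s0 / q s0)) (at s0)"
    by (intro has_vector_derivative_transform_within_open[OF deriv_Ln]) auto
  then show "(L has_vector_derivative q' s0 / q s0) (at s0 within {a..b})"
    by (simp add: has_vector_derivative_at_within)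
qed fact

text \<open>The translated box is cut where the j-th coordinate equals \<open>p\<close>. The part
  beyond the cut, moved back by one period, is the slab of the original box that the translation
  left uncovered.\<close>

lemma integral_periodic_translate:
  fixes G :: "real ^ 'n::finite \<Rightarrow> complex"
  assumes cont: "continuous_on UNIV G" and per: "\<And>\<theta>. G (\<theta> + axis j p) = G \<theta>" and s: "0 \<le> s" "s \<le> p"
  shows "integral (cbox 0 (\<chi> k. p)) (\<lambda>\<theta>. G (\<theta> + axis j s)) = integral (cbox 0 (\<chi> k. p)) G"
proof -
  let ?P = "\<chi> k. p :: real ^ 'n" and ?j = "axis j 1 :: real ^ 'n"
  have int: "G integrable_on cbox a b" for a b
    using cont continuous_on_subset integrable_continuous by blast
  have basis: "?j \<in> Basis" by simp
  have half: "cbox 0 ?P \<inter> {x. x \<bullet> ?j \<le> s} = cbox 0 (?P - axis j (p - s))"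
    and half': "cbox 0 ?P \<inter> {x. x \<bullet> ?j \<ge> s} = cbox (axis j s) ?P"
    and shifted: "cbox (axis j s) (?P + axis j s) \<inter> {x. x \<bullet> ?j \<le> p} = cbox (axis j s) ?P"
    and shifted': "cbox (axis j s) (?P + axis j s) \<inter> {x. x \<bullet> ?j \<ge> p} =
      cbox (0 + axis j p) (?P - axis j (p - s) + axis j p)"
    using s unfolding inner_axis inner_real_def mult_1_right interval_split_cart[unfolded interval_cbox_cart]
    by (auto simp: vec_eq_iff axis_def intro!: arg_cong2[where f = cbox])
  have "integral (cbox 0 ?P) (\<lambda>\<theta>. G (\<theta> + axis j s)) = integral (cbox (axis j s) (?P + axis j s)) G"
    using integral_shift_cbox_plus[of 0 ?P G "axis j s"] by (simp add: comp_def add.commute)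
  also have "\<dots> = integral (cbox (axis j s) ?P) G + integral (cbox (0 + axis j p) (?P - axis j (p - s) + axis j p)) G"
    unfolding integral_split[OF int basis, of "axis j s" "?P + axis j s" p] shifted shifted' ..
  also have "integral (cbox (0 + axis j p) (?P - axis j (p - s) + axis j p)) G =
      integral (cbox 0 (?P - axis j (p - s))) G"
    unfolding integral_shift_cbox_plus[symmetric] by (simp add: comp_def add.commute[of "axis j p"] per)
  also have "integral (cbox (axis j s) ?P) G + integral (cbox 0 (?P - axis j (p - s))) G =
      integral (cbox 0 ?P) G"
    unfolding integral_split[OF int basis, of 0 ?P s] half half' by (rule add.commute)
  finally show ?thesis .
qed

text \<open>The Euler operator, \<open>z\<^sub>j\<close> times the j-th partial derivative, applied
  to \<open>f\<close> on the torus over \<open>w\<close>: each term is multiplied by its j-th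
  exponent.\<close>

definition euler_eval :: "('n::finite, complex) mpoly \<Rightarrow> 'n \<Rightarrow> real ^ 'n \<Rightarrow> real ^ 'n \<Rightarrow> complex" where
  "euler_eval f j w \<theta> =
     (\<Sum>m\<in>Poly_Mapping.keys f. Poly_Mapping.lookup f m * of_nat (m $ j) * torus_monomial w m \<theta>)"

lemma partial_deriv_torus:
  "torus_point w \<theta> $ j * partial_deriv j (\<lambda>z. mp_eval f (($) z)) (torus_point w \<theta>) = euler_eval f j w \<theta>"
proof -
  let ?z = "torus_point w \<theta>"
  let ?R = "\<lambda>m. \<Prod>k\<in>UNIV - {j}. ?z $ k ^ (m $ k)"
  have split: "(\<Prod>k\<in>UNIV. (if k = j then t else ?z $ k) ^ (m $ k)) = t ^ (m $ j) * ?R m" for t m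
    by (subst prod.remove[of _ j]) (auto intro!: prod.cong)
  have eval: "mp_eval f (($) (\<chi> k. if k = j then t else ?z $ k)) =
      (\<Sum>m\<in>Poly_Mapping.keys f. Poly_Mapping.lookup f m * (t ^ (m $ j) * ?R m))" for t
    unfolding mp_eval_expand split[symmetric] by simp
  have "((\<lambda>t. \<Sum>m\<in>Poly_Mapping.keys f. Poly_Mapping.lookup f m * (t ^ (m $ j) * ?R m)) has_field_derivative
      (\<Sum>m\<in>Poly_Mapping.keys f. Poly_Mapping.lookup f m * (of_nat (m $ j) * (?z $ j) ^ (m $ j - 1) * ?R m)))
      (at (?z $ j))"
    by (auto intro!: derivative_eq_intros sum.cong)
  then have "partial_deriv j (\<lambda>z. mp_eval f (($) z)) ?z =
      (\<Sum>m\<in>Poly_Mapping.keys f. Poly_Mapping.lookup f m * (of_nat (m $ j) * (?z $ j) ^ (m $ j - 1) * ?R m))"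
    unfolding partial_deriv_def eval by (rule DERIV_imp_deriv)
  moreover have "?z $ j * (of_nat (m $ j) * (?z $ j) ^ (m $ j - 1) * ?R m) =
      of_nat (m $ j) * torus_monomial w m \<theta>" for m
  proof -
    \<comment> \<open>For \<open>n = 0\<close> the truncated exponent \<open>n - 1\<close> is
      harmless, because the factor \<open>of_nat n\<close> vanishes.\<close>
    have "x * (of_nat n * x ^ (n - 1)) = of_nat n * x ^ n" for x :: complex and n
      by (cases n) auto
    moreover have "torus_monomial w m \<theta> = (?z $ j) ^ (m $ j) * ?R m"
      unfolding torus_monomial_def by (rule prod.remove) auto
    ultimately show ?thesis by (simp only: flip: mult.assoc)
  qed
  ultimately show ?thesis
    unfolding euler_eval_def
    by (simp only: sum_distrib_left, intro sum.cong refl)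
       (subst mult.left_commute, simp only: mult.assoc)
qed

text \<open>Differentiating in the j-th angle is \<i> times the Euler operator, as each monomial
  depends on that angle through an exponential.\<close>

lemma mp_eval_torus_derivative:
  "((\<lambda>s. mp_eval f (($) (torus_point w (\<theta> + axis j s)))) has_vector_derivative
     \<i> * euler_eval f j w (\<theta> + axis j s)) (at s)"
proof -
  have "((\<lambda>s. Poly_Mapping.lookup f m * torus_monomial w m (\<theta> + axis j s)) has_vector_derivative
      \<i> * (Poly_Mapping.lookup f m * of_nat (m $ j) * torus_monomial w m (\<theta> + axis j s))) (at s)" for m
  proof -
    have "((\<lambda>t. exp (\<i> * of_nat (m $ j) * t)) has_field_derivative
        \<i> * of_nat (m $ j) * exp (\<i> * of_nat (m $ j) * of_real s)) (at (of_real s))"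
      by (auto intro!: derivative_eq_intros)
    from has_vector_derivative_real_field[OF this]
    have "((\<lambda>s. (Poly_Mapping.lookup f m * torus_monomial w m \<theta>) * exp (\<i> * of_nat (m $ j) * of_real s))
        has_vector_derivative (Poly_Mapping.lookup f m * torus_monomial w m \<theta>) *
          (\<i> * of_nat (m $ j) * exp (\<i> * of_nat (m $ j) * of_real s))) (at s)"
      by (rule has_vector_derivative_mult_right)
    then show ?thesis
      by (simp add: torus_monomial_add_axis mult_ac)
  qed
  then show ?thesis
    unfolding mp_eval_torus euler_eval_def sum_distrib_left by (rule has_vector_derivative_sum)
qed

lemma amoeba_order_eq_winding:
  fixes f :: "('n::finite, complex) mpoly"
  assumes w: "w \<notin> amoeba f" and winds: "winds (\<lambda>\<theta>. mp_eval f (($) (torus_point w \<theta>))) j \<nu>"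
  shows "amoeba_order f w $ j = of_int \<nu>"
proof -
  define F where "F \<theta> = mp_eval f (($) (torus_point w \<theta>))" for \<theta>
  define G where "G \<theta> = euler_eval f j w \<theta> / F \<theta>" for \<theta>
  let ?P = "(\<chi> k. 2 * pi) :: real ^ 'n"
  have F: "F \<theta> \<noteq> 0" for \<theta>
    using w by (auto simp: mem_amoeba_iff F_def)
  have contF: "continuous_on UNIV F"
    unfolding F_def by (intro continuous_intros)
  have "continuous_on UNIV (euler_eval f j w)"
    unfolding euler_eval_def by (intro continuous_intros)
  then have contG: "continuous_on UNIV G"
    unfolding G_def using F by (intro continuous_intros contF) auto
  have perG: "G (\<theta> + axis j (2 * pi)) = G \<theta>" for \<theta>
    by (simp add: G_def F_def mp_eval_torus_periodic euler_eval_def torus_monomial_periodic)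
  obtain L where L: "continuous_on UNIV L" "\<And>\<theta>. F \<theta> = exp (L \<theta>)"
      "\<And>\<theta>. L (\<theta> + axis j (2 * pi)) = L \<theta> + 2 * of_real pi * \<i> * of_int \<nu>"
    using winds by (auto simp: winds_def F_def)
  \<comment> \<open>Along a circle in direction \<open>j\<close>, \<i> times \<open>G\<close> is the
    logarithmic derivative of \<open>F\<close>, so its integral is the increment of
    \<open>L\<close>; the factor \<i> is removed afterwards.\<close>
  have inner: "integral {0..2 * pi} (\<lambda>s. G (\<theta> + axis j s)) = 2 * of_real pi * of_int \<nu>" for \<theta>
  proof -
    have axis_zero: "axis j 0 = (0 :: real ^ 'n)"
      by (simp add: vec_eq_iff axis_def)
    have cont_axis: "continuous_on UNIV (\<lambda>s. axis j s :: real ^ 'n)"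
      by (intro linear_continuous_on linear_conv_bounded_linear[THEN iffD1] linearI)
         (auto simp: vec_eq_iff axis_def)
    have "((\<lambda>s. \<i> * euler_eval f j w (\<theta> + axis j s) / F (\<theta> + axis j s)) has_integral
        L (\<theta> + axis j (2 * pi)) - L (\<theta> + axis j 0)) {0..2 * pi}"
      using mp_eval_torus_derivative[of f w \<theta> j] L(2)
      by (intro integral_log_derivative) (auto simp: F_def intro!: continuous_on_compose2[OF L(1)] continuous_intros cont_axis)
    then have "((\<lambda>s. \<i> * G (\<theta> + axis j s)) has_integral 2 * of_real pi * \<i> * of_int \<nu>) {0..2 * pi}"
      by (simp add: G_def L(3) axis_zero)
    from has_integral_mult_right[OF this, of "- \<i>"] show ?thesis
      by (intro integral_unique) (simp add: mult.left_commute mult.commute)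
  qed
  have cont_swap: "continuous_on A (\<lambda>(s, \<theta>). G (\<theta> + axis j s))" for A
  proof -
    have scale: "s *\<^sub>R axis j 1 = axis j s" for s :: real
      by (simp add: vec_eq_iff axis_def)
    have "continuous_on A (\<lambda>x. G (snd x + fst x *\<^sub>R axis j 1))"
      by (intro continuous_on_compose2[OF contG] continuous_intros) auto
    then show ?thesis
      by (simp only: scale case_prod_unfold)
  qed
  \<comment> \<open>By periodicity \<open>G\<close> may be averaged over its translates along the \<open>j\<close>-th axis; swapping the
    integrals leaves the winding number, which does not depend on \<open>\<theta>\<close>, as the inner integral.\<close>
  have "of_real (2 * pi) * integral (cbox 0 ?P) G = integral (cbox 0 (2 * pi)) (\<lambda>s. integral (cbox 0 ?P) G)"
    by (simp add: scaleR_conv_of_real)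
  also have "\<dots> = integral (cbox 0 (2 * pi)) (\<lambda>s. integral (cbox 0 ?P) (\<lambda>\<theta>. G (\<theta> + axis j s)))"
    by (rule integral_cong) (use contG perG in \<open>auto simp: integral_periodic_translate\<close>)
  also have "\<dots> = integral (cbox 0 ?P) (\<lambda>\<theta>. integral (cbox 0 (2 * pi)) (\<lambda>s. G (\<theta> + axis j s)))"
    by (rule integral_swap_continuous[OF cont_swap])
  also have "\<dots> = of_real ((2 * pi) ^ CARD('n)) * (2 * of_real pi * of_int \<nu>)"
    by (simp add: inner content_cbox_cart interval_eq_empty_cart scaleR_conv_of_real)
  finally have integral: "integral (cbox 0 ?P) G = of_real ((2 * pi) ^ CARD('n)) * of_int \<nu>"
    by simp
  have "amoeba_order f w $ j = 1 / (2 * of_real pi * \<i>) ^ CARD('n) * integral (cbox 0 ?P) (\<lambda>\<theta>. \<i> ^ CARD('n) * G \<theta>)"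
  proof -
    \<comment> \<open>The coordinates in the Jacobian cancel the denominator of the integrand; the
      remaining power of \<i> will cancel against the normalizing constant.\<close>
    have "(\<Prod>k\<in>UNIV. \<i> * torus_point w \<theta> $ k) = \<i> ^ CARD('n) * (\<Prod>k\<in>UNIV. torus_point w \<theta> $ k)" for \<theta>
      by (simp add: prod.distrib)
    then have "torus_point w \<theta> $ j * partial_deriv j (\<lambda>z. mp_eval f (($) z)) (torus_point w \<theta>)
        / mp_eval f (($) (torus_point w \<theta>)) / (\<Prod>k\<in>UNIV. torus_point w \<theta> $ k)
        * (\<Prod>k\<in>UNIV. \<i> * torus_point w \<theta> $ k) = \<i> ^ CARD('n) * G \<theta>" for \<theta>
      by (simp add: partial_deriv_torus G_def F_def)
    then show ?thesis
      unfolding amoeba_order_def torus_integral_def by simp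
  qed
  also have "\<dots> = of_int \<nu>"
    by (simp add: integral power_mult_distrib)
  finally show ?thesis .
qed

section \<open>Cyclic products\<close>

lemma
  shows finite_cyclic_index: "finite {k :: 'n::finite \<Rightarrow> nat. \<forall>j. k j < r}"
    and card_cyclic_index: "card {k :: 'n \<Rightarrow> nat. \<forall>j. k j < r} = r ^ CARD('n)"
proof -
  have eq: "{k :: 'n \<Rightarrow> nat. \<forall>j. k j < r} = (UNIV \<rightarrow>\<^sub>E {..<r})"
    by (auto simp: PiE_def Pi_def extensional_def)
  show "finite {k :: 'n \<Rightarrow> nat. \<forall>j. k j < r}"
    unfolding eq by (intro finite_PiE) auto
  show "card {k :: 'n \<Rightarrow> nat. \<forall>j. k j < r} = r ^ CARD('n)"
    unfolding eq by (subst card_funcsetE) auto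
qed

text \<open>Rotations and the positive rescaling commute. Hence lopsidedness of the cyclic product
  of the centred polynomial at 0 is lopsidedness of the cyclic product of \<open>f\<close> at
  \<open>w\<close>.\<close>

lemma cyclic_product_centred: "cyclic_product r (centred w f) = centred w (cyclic_product r f)"
  unfolding cyclic_product_def centred_def rescale_prod rescale_rescale by (simp add: mult.commute)

text \<open>Moduli of the scaling factors move the torus, their arguments translate the angles.
  Centring is the case of zero angles, the rotations of the cyclic product are the case of modulus
  1.\<close>

lemma mp_eval_rescale_torus:
  "mp_eval (rescale (\<lambda>j. exp (Complex (v $ j) (\<tau> $ j))) f) (($) (torus_point w \<theta>)) =
     mp_eval f (($) (torus_point (w + v) (\<theta> + \<tau>)))"
proof -
  have "(\<lambda>k. exp (Complex (v $ k) (\<tau> $ k)) * torus_point w \<theta> $ k) = ($) (torus_point (w + v) (\<theta> + \<tau>))"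
    by (simp add: fun_eq_iff torus_point_def add.commute flip: exp_add complex_add)
  then show ?thesis
    by (simp add: mp_eval_rescale)
qed

lemma mp_eval_centred_torus:
  "mp_eval (centred v f) (($) (torus_point w \<theta>)) = mp_eval f (($) (torus_point (w + v) \<theta>))"
proof -
  have "complex_of_real (exp x) = exp (Complex x 0)" for x
    by (simp add: Complex_eq exp_of_real)
  then show ?thesis
    using mp_eval_rescale_torus[of v 0 f w \<theta>] by (simp add: centred_def)
qed

lemma mp_eval_cyclic_product_torus:
  "mp_eval (cyclic_product r f) (($) (torus_point w \<theta>)) =
     (\<Prod>k\<in>{k. \<forall>j. k j < r}. mp_eval f (($) (torus_point w (\<theta> + (\<chi> j. 2 * pi * real (k j) / real r)))))"
proof -
  have "exp (2 * of_real pi * \<i> * of_nat (k j) / of_nat r) =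
      exp (Complex (0 $ j) ((\<chi> j. 2 * pi * real (k j) / real r) $ j))" for k :: "'a \<Rightarrow> nat" and j
    by (rule arg_cong[of _ _ exp]) (simp add: complex_eq_iff)
  then show ?thesis
    unfolding cyclic_product_def mp_eval_simps
    by (simp only: mp_eval_rescale_torus add_0_right)
qed

text \<open>The factor with index 0 is \<open>f\<close> itself; \<open>r \<ge> 1\<close> makes that
  index admissible.\<close>

lemma amoeba_subset_cyclic_product:
  assumes "r \<ge> 1"
  shows "amoeba f \<subseteq> amoeba (cyclic_product r f)"
proof
  fix w assume "w \<in> amoeba f"
  then obtain \<theta> where \<theta>: "mp_eval f (($) (torus_point w \<theta>)) = 0"
    by (auto simp: mem_amoeba_iff)
  have zero: "(\<chi> j. 2 * pi * real ((\<lambda>_. 0 :: nat) j) / real r) = (0 :: real ^ 'a)"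
    by (simp add: vec_eq_iff)
  have "mp_eval (cyclic_product r f) (($) (torus_point w \<theta>)) = 0"
    unfolding mp_eval_cyclic_product_torus
    by (rule prod_zero[OF finite_cyclic_index], rule bexI[of _ "\<lambda>_. 0"])
       (use assms \<theta> zero in auto)
  then show "w \<in> amoeba (cyclic_product r f)"
    by (auto simp: mem_amoeba_iff)
qed

lemma total_degree_cyclic_product_le:
  fixes f :: "('n::finite, complex) mpoly"
  shows "total_degree (cyclic_product r f) \<le> r ^ CARD('n) * total_degree f"
proof -
  have "total_degree (cyclic_product r f) \<le> (\<Sum>k\<in>{k :: 'n \<Rightarrow> nat. \<forall>j. k j < r}. total_degree f)"
    unfolding cyclic_product_def
    by (rule order.trans[OF total_degree_prod_le]) (intro sum_mono total_degree_rescale_le)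
  then show ?thesis by (simp add: card_cyclic_index)
qed

section \<open>Centring and term moduli\<close>

lemma lookup_centred:
  "Poly_Mapping.lookup (centred w h) m = Poly_Mapping.lookup h m * of_real (exp (exponent_vector m \<bullet> w))"
proof -
  have "(\<Prod>k\<in>UNIV. exp (w $ k) ^ (m $ k)) = exp (exponent_vector m \<bullet> w)"
    by (simp add: inner_vec_def exponent_vector_def exp_sum exp_of_nat_mult)
  then show ?thesis
    by (simp add: centred_def lookup_rescale flip: of_real_power of_real_prod)
qed

lemma keys_centred: "Poly_Mapping.keys (centred w h) = Poly_Mapping.keys h"
  by (auto simp: in_keys_iff lookup_centred)

lemma term_moduli_centred: "term_moduli (centred w h) 0 = term_moduli h w"
  by (simp add: fun_eq_iff term_moduli_def lookup_centred norm_mult)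

section \<open>The order at a point where the cyclic product is lopsided\<close>

text \<open>On the torus over \<open>w\<close> the term moduli are constant, so lopsidedness says
  that all other terms together are smaller than the dominating one, and Rouche transfers the
  winding number of a monomial.\<close>

lemma winds_dominating:
  assumes "dominating (Poly_Mapping.keys h) (term_moduli h w) m"
  shows "winds (\<lambda>\<theta>. mp_eval h (($) (torus_point w \<theta>))) j (int (m $ j))"
proof (rule winds_Rouche)
  let ?c = "Poly_Mapping.lookup h"
  have m: "m \<in> Poly_Mapping.keys h"
    using assms by (simp add: dominating_def)
  then show "winds (\<lambda>\<theta>. ?c m * torus_monomial w m \<theta>) j (int (m $ j))"
    by (intro winds_torus_monomial) (simp add: in_keys_iff)
  show "continuous_on UNIV (\<lambda>\<theta>. mp_eval h (($) (torus_point w \<theta>)))"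
    by (intro continuous_intros)
  show "mp_eval h (($) (torus_point w (\<theta> + axis j (2 * pi)))) = mp_eval h (($) (torus_point w \<theta>))" for \<theta>
    by (rule mp_eval_torus_periodic)
  have modulus: "cmod (?c l * torus_monomial w l \<theta>) = term_moduli h w l" for l \<theta>
    by (simp add: norm_mult norm_torus_monomial term_moduli_def)
  show "cmod (mp_eval h (($) (torus_point w \<theta>)) - ?c m * torus_monomial w m \<theta>)
      < cmod (?c m * torus_monomial w m \<theta>)" for \<theta>
  proof -
    have "mp_eval h (($) (torus_point w \<theta>)) - ?c m * torus_monomial w m \<theta> =
        (\<Sum>l\<in>Poly_Mapping.keys h - {m}. ?c l * torus_monomial w l \<theta>)"
      unfolding mp_eval_torus by (subst sum.remove[OF _ m]) auto
    also have "cmod \<dots> \<le> (\<Sum>l\<in>Poly_Mapping.keys h - {m}. term_moduli h w l)"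
      by (rule order.trans[OF norm_sum]) (simp only: modulus order.refl)
    also have "\<dots> < cmod (?c m * torus_monomial w m \<theta>)"
      using assms by (simp only: modulus dominating_def)
    finally show ?thesis .
  qed
qed

lemma winds_not_mem_amoeba:
  "winds (\<lambda>\<theta>. mp_eval h (($) (torus_point w \<theta>))) j \<nu> \<Longrightarrow> w \<notin> amoeba h"
  by (auto simp: winds_def mem_amoeba_iff)

lemma not_mem_amoeba_winds:
  assumes "w \<notin> amoeba f"
  obtains \<nu> where "winds (\<lambda>\<theta>. mp_eval f (($) (torus_point w \<theta>))) j \<nu>"
proof (rule winds_exists[where j = j])
  show "continuous_on UNIV (\<lambda>\<theta>. mp_eval f (($) (torus_point w \<theta>)))"
    by (intro continuous_intros)
  show "mp_eval f (($) (torus_point w \<theta>)) \<noteq> 0" for \<theta>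
    using assms by (auto simp: mem_amoeba_iff)
qed (use that in \<open>auto simp: mp_eval_torus_periodic\<close>)

lemma not_lopsided_amoeba_subset:
  assumes "r \<ge> 1"
  shows "- lopsided_amoeba (cyclic_product r f) \<subseteq> - amoeba f"
proof (rule subsetI)
  fix w assume "w \<in> - lopsided_amoeba (cyclic_product r f)"
  then obtain m where
    "dominating (Poly_Mapping.keys (cyclic_product r f)) (term_moduli (cyclic_product r f) w) m"
    by (auto simp: lopsided_amoeba_def lopsided_def)
  then have "w \<notin> amoeba (cyclic_product r f)"
    by (rule winds_not_mem_amoeba[OF winds_dominating])
  then show "w \<in> - amoeba f"
    using amoeba_subset_cyclic_product[OF assms] by blast
qed

text \<open>Translating the angles does not change a winding number, so all factors of the cyclic
  product wind equally often. Comparison with the dominating exponent shows that the division by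
  \<open>r ^ CARD('n)\<close> is exact.\<close>

lemma amoeba_order_dominating:
  fixes f :: "('n::finite, complex) mpoly"
  assumes dom: "dominating (Poly_Mapping.keys (cyclic_product r f)) (term_moduli (cyclic_product r f) w) m"
    and r: "r \<ge> 1"
  shows "w \<notin> amoeba f" "amoeba_order f w = (\<chi> j. of_int (int (m $ j) div int (r ^ CARD('n))))"
proof -
  have "w \<in> - lopsided_amoeba (cyclic_product r f)"
    using dom by (auto simp: lopsided_amoeba_def lopsided_def)
  then show w: "w \<notin> amoeba f"
    using not_lopsided_amoeba_subset[OF r, of f] by auto
  have "amoeba_order f w $ j = of_int (int (m $ j) div int (r ^ CARD('n)))" for j
  proof -
    obtain \<nu> where \<nu>: "winds (\<lambda>\<theta>. mp_eval f (($) (torus_point w \<theta>))) j \<nu>"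
      using not_mem_amoeba_winds[OF w] .
    have "winds (\<lambda>\<theta>. mp_eval (cyclic_product r f) (($) (torus_point w \<theta>))) j (int (r ^ CARD('n)) * \<nu>)"
      unfolding mp_eval_cyclic_product_torus card_cyclic_index[symmetric]
      by (intro winds_prod winds_translate[OF \<nu>])
    then have "int (r ^ CARD('n)) * \<nu> = int (m $ j)"
      using winds_dominating[OF dom] by (rule winds_unique)
    moreover have "int (r ^ CARD('n)) \<noteq> 0"
      using r by simp
    ultimately have "\<nu> = int (m $ j) div int (r ^ CARD('n))"
      by (metis nonzero_mult_div_cancel_left)
    then show ?thesis
      using amoeba_order_eq_winding[OF w \<nu>] by simp
  qed
  then show "amoeba_order f w = (\<chi> j. of_int (int (m $ j) div int (r ^ CARD('n))))"
    by (simp add: vec_eq_iff)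
qed

section \<open>Local constancy of the order\<close>

text \<open>Brings the angles into a compact box. The reduced angles do not depend on
  \<open>w\<close>, so tori over different points can be compared at the same angles.\<close>

lemma torus_point_reduce:
  obtains \<theta>' where "\<theta>' \<in> cbox 0 (\<chi> k. 2 * pi)" "\<And>w. torus_point w \<theta>' = torus_point w \<theta>"
proof
  let ?\<theta>' = "\<chi> k. \<theta> $ k - 2 * pi * of_int \<lfloor>\<theta> $ k / (2 * pi)\<rfloor>"
  have "x - 2 * pi * of_int \<lfloor>x / (2 * pi)\<rfloor> \<in> {0..2 * pi}" for x :: real
  proof -
    have "of_int \<lfloor>x / (2 * pi)\<rfloor> * (2 * pi) \<le> x"
      using of_int_floor_le[of "x / (2 * pi)"] by (simp only: pos_le_divide_eq[of "2 * pi"] pi_gt_zero mult_pos_pos zero_less_numeral)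
    moreover have "x < (of_int \<lfloor>x / (2 * pi)\<rfloor> + 1) * (2 * pi)"
      using floor_correct[of "x / (2 * pi)"] by (simp only: pos_divide_less_eq[of "2 * pi"] pi_gt_zero mult_pos_pos zero_less_numeral of_int_add of_int_1)
    ultimately show ?thesis by (simp add: algebra_simps)
  qed
  then show "?\<theta>' \<in> cbox 0 (\<chi> k. 2 * pi)"
    by (simp add: mem_box_cart)
  have "exp (Complex a (x - 2 * pi * of_int n)) = exp (Complex a x)" for a x n
    unfolding exp_eq by (rule exI[of _ "- n"]) (simp add: complex_eq_iff)
  then show "torus_point w ?\<theta>' = torus_point w \<theta>" for w
    by (simp add: vec_eq_iff torus_point_def)
qed

text \<open>On the compact box of angles the modulus over \<open>w\<close> has a positive minimum.
  For \<open>w'\<close> near \<open>w\<close> the values differ by at most half of it, uniformly in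
  the angles, and Rouche applies for all \<open>j\<close> at once.\<close>

lemma eventually_winds:
  fixes f :: "('n::finite, complex) mpoly"
  assumes "w \<notin> amoeba f"
  shows "\<forall>\<^sub>F w' in nhds w. \<forall>j \<nu>. winds (\<lambda>\<theta>. mp_eval f (($) (torus_point w \<theta>))) j \<nu> \<longrightarrow>
    winds (\<lambda>\<theta>. mp_eval f (($) (torus_point w' \<theta>))) j \<nu>"
proof -
  let ?F = "\<lambda>w \<theta>. mp_eval f (($) (torus_point w \<theta>))"
  let ?C = "cbox 0 (\<chi> k. 2 * pi) :: (real ^ 'n) set"
  have "\<exists>\<theta>\<^sub>0\<in>?C. \<forall>\<theta>\<in>?C. cmod (?F w \<theta>\<^sub>0) \<le> cmod (?F w \<theta>)"
    by (intro continuous_attains_inf compact_cbox continuous_intros)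
       (simp add: interval_eq_empty_cart not_less)
  then obtain \<theta>\<^sub>0 where min: "\<And>\<theta>. \<theta> \<in> ?C \<Longrightarrow> cmod (?F w \<theta>\<^sub>0) \<le> cmod (?F w \<theta>)" by blast
  have pos: "0 < cmod (?F w \<theta>\<^sub>0)"
    using assms by (auto simp: mem_amoeba_iff)
  have "continuous_on (UNIV \<times> ?C) (\<lambda>(w, \<theta>). ?F w \<theta>)"
    unfolding case_prod_unfold by (intro continuous_intros)
  then obtain X where X: "w \<in> X" "open X"
    and "\<forall>w'\<in>X \<inter> UNIV. \<forall>\<theta>\<in>?C. dist ((\<lambda>(w, \<theta>). ?F w \<theta>) (w', \<theta>)) ((\<lambda>(w, \<theta>). ?F w \<theta>) (w, \<theta>))
      \<le> cmod (?F w \<theta>\<^sub>0) / 2"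
    by (rule continuous_on_prod_compactE[OF _ compact_cbox UNIV_I half_gt_zero[OF pos]])
  then have close: "dist (?F w' \<theta>) (?F w \<theta>) \<le> cmod (?F w \<theta>\<^sub>0) / 2" if "w' \<in> X" "\<theta> \<in> ?C" for w' \<theta>
    using that by simp
  have less: "cmod (?F w' \<theta> - ?F w \<theta>) < cmod (?F w \<theta>)" if "w' \<in> X" for w' \<theta>
  proof -
    obtain \<theta>' where \<theta>': "\<theta>' \<in> ?C" "\<And>w. torus_point w \<theta>' = torus_point w \<theta>"
      using torus_point_reduce[of \<theta>] by blast
    show ?thesis
      using close[OF that \<theta>'(1)] min[OF \<theta>'(1)] pos unfolding \<theta>'(2) dist_norm by linarith
  qed
  have "winds (?F w') j \<nu>" if "w' \<in> X" "winds (?F w) j \<nu>" for w' j \<nu>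
    by (rule winds_Rouche[OF that(2)])
       (auto simp: less that(1) mp_eval_torus_periodic intro!: continuous_intros)
  then show ?thesis
    using X by (auto simp: eventually_nhds)
qed

lemma amoeba_order_constant:
  assumes "w' \<in> connected_component_set (- amoeba f) w"
  shows "amoeba_order f w' = amoeba_order f w"
proof (rule connected_local_const[of "connected_component_set (- amoeba f) w" w' w])
  show "w \<in> connected_component_set (- amoeba f) w"
    using assms by (metis connected_component_in connected_component_refl mem_Collect_eq)
  show "\<forall>a\<in>connected_component_set (- amoeba f) w.
      \<forall>\<^sub>F b in at a within connected_component_set (- amoeba f) w. amoeba_order f a = amoeba_order f b"
  proof
    fix a assume "a \<in> connected_component_set (- amoeba f) w"
    then have a: "a \<notin> amoeba f"
      using connected_component_subset by blast
    have "\<forall>\<^sub>F b in nhds a. amoeba_order f a = amoeba_order f b"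
      using eventually_winds[OF a]
    proof eventually_elim
      case (elim b)
      have "amoeba_order f a $ j = amoeba_order f b $ j" for j
      proof -
        obtain \<nu> where \<nu>: "winds (\<lambda>\<theta>. mp_eval f (($) (torus_point a \<theta>))) j \<nu>"
          using not_mem_amoeba_winds[OF a] .
        with elim have b: "winds (\<lambda>\<theta>. mp_eval f (($) (torus_point b \<theta>))) j \<nu>" by blast
        show ?thesis
          using amoeba_order_eq_winding[OF a \<nu>] amoeba_order_eq_winding[OF winds_not_mem_amoeba[OF b] b]
          by simp
      qed
      then show ?case by (simp add: vec_eq_iff)
    qed
    then show "\<forall>\<^sub>F b in at a within connected_component_set (- amoeba f) w. amoeba_order f a = amoeba_order f b"
      by (simp add: eventually_at_filter eventually_mono)
  qed
qed (use assms in simp_all)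

section \<open>Certificates for points outside the lopsided amoeba\<close>

lemma dominating_enumeration_exists:
  assumes "dominating (Poly_Mapping.keys h) (term_moduli h 0) m"
  obtains \<beta> where "dominating_enumeration h \<beta>"
proof -
  let ?K = "Poly_Mapping.keys h"
  have m: "m \<in> ?K" using assms by (simp add: dominating_def)
  obtain b where b: "bij_betw b {1..card ?K} ?K"
    using ex_bij_betw_nat_finite_1[of ?K] by auto
  have "m \<in> b ` {1..card ?K}"
    using b m by (simp add: bij_betw_def)
  then obtain i where i: "i \<in> {1..card ?K}" "b i = m" by blast
  \<comment> \<open>An arbitrary enumeration is corrected by swapping the dominating exponent into
    position 1.\<close>
  then have "bij_betw (Transposition.transpose 1 i) {1..card ?K} {1..card ?K}"
    by (simp add: bij_betw_def)
  then have "bij_betw (b \<circ> Transposition.transpose 1 i) {1..card ?K} ?K"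
    using b by (rule bij_betw_trans)
  with assms i have "dominating_enumeration h (b \<circ> Transposition.transpose 1 i)"
    by (simp add: dominating_enumeration_def)
  then show ?thesis by (rule that)
qed

text \<open>The point 1 corresponds to the unit torus, the fibre of the logarithm map over 0, and
  centring moves the fibre over \<open>w\<close> there.\<close>

lemma unlog_amoeba_centred:
  assumes "w \<notin> amoeba f"
  shows "1 \<notin> unlog_amoeba (centred w f)"
proof
  assume "1 \<in> unlog_amoeba (centred w f)"
  then obtain z :: "complex ^ 'a" where z: "\<And>k. cmod (z $ k) = 1" "mp_eval (centred w f) (($) z) = 0"
    by (auto simp: unlog_amoeba_def vec_eq_iff)
  have "0 \<in> amoeba (centred w f)"
    unfolding amoeba_def using z by (auto simp: Log_map_def vec_eq_iff intro!: exI[of _ z]) (metis norm_zero zero_neq_one)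
  then show False
    using assms by (auto simp: mem_amoeba_iff mp_eval_centred_torus)
qed

text \<open>Again because of the factor with index 0; thus a certificate built from the cyclic
  product also excludes zeros of \<open>g\<close>.\<close>

lemma mp_eval_cyclic_product_zero:
  assumes "r \<ge> 1" "mp_eval g x = 0"
  shows "mp_eval (cyclic_product r g) x = 0"
  unfolding cyclic_product_def mp_eval_simps mp_eval_rescale
  by (rule prod_zero[OF finite_cyclic_index], rule bexI[of _ "\<lambda>_. 0"]) (use assms in auto)

lemma certificate_for_certifies:
  fixes f :: "('n::finite, complex) mpoly"
  assumes "certificate_for f r w C" "r \<ge> 1"
  shows "certificate_identity C" "certifies_one C (centred w f)"
    "certificate_degree C \<le> 2 * r ^ CARD('n) * total_degree f"
proof -
  let ?h = "cyclic_product r (centred w f)"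
  obtain \<beta> where \<beta>: "dominating_enumeration ?h \<beta>" and C: "C = lopsidedness_certificate ?h \<beta>"
    using assms(1) by (auto simp: certificate_for_def)
  interpret lopsided_poly ?h \<beta> by unfold_locales (rule \<beta>)
  show "certificate_identity C"
    unfolding C by (rule identity)
  then show "certifies_one C (centred w f)"
    using sum_of_squares_H mp_eval_cyclic_product_zero[OF assms(2), of "centred w f"]
    by (auto simp: certifies_one_def C certificate_eq sum_of_squares_def intro!: summand_vanishes)
  have "total_degree ?h \<le> r ^ CARD('n) * total_degree f"
    by (rule order.trans[OF total_degree_cyclic_product_le])
       (simp add: centred_def total_degree_rescale_le)
  then show "certificate_degree C \<le> 2 * r ^ CARD('n) * total_degree f"
    unfolding C using degree by (simp add: order.trans)
qed

text \<open>Links the certificate to the order through the same exponent \<open>m\<close>, namely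
  the dominating one, without mentioning the enumeration from which the certificate was
  built.\<close>

lemma certificate_for_order:
  fixes f :: "('n::finite, complex) mpoly"
  assumes "certificate_for f r w C" "r \<ge> 1"
  obtains m where "\<And>j. mp_eval (fst (hd (summands C))) (case_sum (\<lambda>k. if k = j then 2 else 1) (\<lambda>_. 0)) =
      4 ^ (m $ j) - 1"
    and "amoeba_order f w = (\<chi> j. of_int (int (m $ j) div int (r ^ CARD('n))))"
proof -
  let ?h = "cyclic_product r (centred w f)"
  obtain \<beta> where \<beta>: "dominating_enumeration ?h \<beta>" and C: "C = lopsidedness_certificate ?h \<beta>"
    using assms(1) by (auto simp: certificate_for_def)
  interpret lopsided_poly ?h \<beta> by unfold_locales (rule \<beta>)
  have "dominating (Poly_Mapping.keys (cyclic_product r f)) (term_moduli (cyclic_product r f) w) (\<beta> 1)"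
    using \<beta> by (simp add: dominating_enumeration_def cyclic_product_centred keys_centred term_moduli_centred)
  from amoeba_order_dominating(2)[OF this assms(2)] show ?thesis
    using first_summand that unfolding C by blast
qed

lemma certificate_for_exists:
  assumes "w \<in> - lopsided_amoeba (cyclic_product r f)"
  obtains C where "certificate_for f r w C"
proof -
  obtain m where "dominating (Poly_Mapping.keys (cyclic_product r f)) (term_moduli (cyclic_product r f) w) m"
    using assms by (auto simp: lopsided_amoeba_def lopsided_def)
  then have "dominating (Poly_Mapping.keys (cyclic_product r (centred w f)))
      (term_moduli (cyclic_product r (centred w f)) 0) m"
    by (simp add: cyclic_product_centred keys_centred term_moduli_centred)
  then obtain \<beta> where "dominating_enumeration (cyclic_product r (centred w f)) \<beta>"
    by (rule dominating_enumeration_exists)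
  then have "certificate_for f r w (lopsidedness_certificate (cyclic_product r (centred w f)) \<beta>)"
    by (auto simp: certificate_for_def)
  then show ?thesis by (rule that)
qed

text \<open>Different points, or different enumerations, might yield the same certificate. It
  suffices that the order agrees for any two points sharing one; a choice over all certificates then
  gives \<Phi>.\<close>

lemma certificate_determines_order:
  fixes f :: "('n::finite, complex) mpoly"
  assumes "r \<ge> 1"
  shows "\<exists>\<Phi> :: ('n + 'n, real) mpoly certificate \<Rightarrow> int ^ 'n. \<forall>w C. certificate_for f r w C \<longrightarrow>
    amoeba_order f w = (\<chi> j. of_int (\<Phi> C $ j))"
proof -
  have unique: "amoeba_order f w = amoeba_order f w'"
    if C: "certificate_for f r w C" "certificate_for f r w' C" for w w' C
  proof -
    obtain m where m: "\<And>j. mp_eval (fst (hd (summands C))) (case_sum (\<lambda>k. if k = j then 2 else 1) (\<lambda>_. 0)) = 4 ^ (m $ j) - 1"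
      "amoeba_order f w = (\<chi> j. of_int (int (m $ j) div int (r ^ CARD('n))))"
      using certificate_for_order[OF C(1) assms] by blast
    obtain m' where m': "\<And>j. mp_eval (fst (hd (summands C))) (case_sum (\<lambda>k. if k = j then 2 else 1) (\<lambda>_. 0)) = 4 ^ (m' $ j) - 1"
      "amoeba_order f w' = (\<chi> j. of_int (int (m' $ j) div int (r ^ CARD('n))))"
      using certificate_for_order[OF C(2) assms] by blast
    have "(4 :: real) ^ (m $ j) = 4 ^ (m' $ j)" for j
      using m(1)[of j] m'(1)[of j] by simp
    then show ?thesis
      by (simp add: m(2) m'(2))
  qed
  have "\<exists>\<nu> :: int ^ 'n. \<forall>w. certificate_for f r w C \<longrightarrow> amoeba_order f w = (\<chi> j. of_int (\<nu> $ j))" for C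
  proof (cases "\<exists>w. certificate_for f r w C")
    case True
    then obtain w where w: "certificate_for f r w C" ..
    obtain m where m: "amoeba_order f w = (\<chi> j. of_int (int (m $ j) div int (r ^ CARD('n))))"
      using certificate_for_order[OF w assms] by blast
    show ?thesis
      by (rule exI[of _ "\<chi> j. int (m $ j) div int (r ^ CARD('n))"]) (simp add: unique[OF _ w] m)
  \<comment> \<open>If no point has \<open>C\<close> as a certificate, the condition is void and any
    vector will do.\<close>
  qed auto
  then show ?thesis by metis
qed

theorem corollary4p4:
  fixes \<alpha> :: "nat \<Rightarrow> nat ^ 'n" and b :: "nat \<Rightarrow> complex" and d r :: nat
    and f :: "('n, complex) mpoly"
  assumes "inj_on \<alpha> {1..d}"
    and "span (exponent_vector ` \<alpha> ` {1..d}) = UNIV"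
    and "\<And>j. j \<in> {1..d} \<Longrightarrow> b j \<noteq> 0"
    and "f = (\<Sum>j=1..d. Poly_Mapping.single (\<alpha> j) (b j))"
    and "r \<ge> 1"
  shows "- lopsided_amoeba (cyclic_product r f) \<subseteq> - amoeba f \<and>
    (\<forall>w \<in> - lopsided_amoeba (cyclic_product r f).
       \<exists>C. certificate_for f r w C \<and>
           certificate_identity C \<and>
           certifies_one C (centred w f) \<and>
           1 \<notin> unlog_amoeba (centred w f) \<and>
           certificate_degree C \<le> 2 * r ^ CARD('n) * total_degree f) \<and>
    (\<exists>\<Phi> :: ('n + 'n, real) mpoly certificate \<Rightarrow> int ^ 'n.
       \<forall>w \<in> - lopsided_amoeba (cyclic_product r f). \<forall>C. certificate_for f r w C \<longrightarrow>
         (\<forall>w' \<in> connected_component_set (- amoeba f) w.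
            amoeba_order f w' = (\<chi> j. of_int (\<Phi> C $ j))))"
proof (intro conjI ballI)
  show subset: "- lopsided_amoeba (cyclic_product r f) \<subseteq> - amoeba f"
    by (rule not_lopsided_amoeba_subset[OF assms(5)])
  show "\<exists>C. certificate_for f r w C \<and> certificate_identity C \<and> certifies_one C (centred w f) \<and>
      1 \<notin> unlog_amoeba (centred w f) \<and> certificate_degree C \<le> 2 * r ^ CARD('n) * total_degree f"
    if w: "w \<in> - lopsided_amoeba (cyclic_product r f)" for w
  proof -
    obtain C where C: "certificate_for f r w C"
      using certificate_for_exists[OF w] .
    have "1 \<notin> unlog_amoeba (centred w f)"
      using w subset by (intro unlog_amoeba_centred) auto
    with C certificate_for_certifies[OF C assms(5)] show ?thesis by blast
  qed
  obtain \<Phi> :: "('n + 'n, real) mpoly certificate \<Rightarrow> int ^ 'n" where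
    "\<And>w C. certificate_for f r w C \<Longrightarrow> amoeba_order f w = (\<chi> j. of_int (\<Phi> C $ j))"
    using certificate_determines_order[OF assms(5)] by blast
  \<comment> \<open>The vector is read off at \<open>w\<close> and carried over its component by
    constancy of the order.\<close>
  then have "amoeba_order f w' = (\<chi> j. of_int (\<Phi> C $ j))"
    if "certificate_for f r w C" "w' \<in> connected_component_set (- amoeba f) w" for w w' C
    using that amoeba_order_constant[OF that(2)] by simp
  then show "\<exists>\<Phi> :: ('n + 'n, real) mpoly certificate \<Rightarrow> int ^ 'n.
       \<forall>w \<in> - lopsided_amoeba (cyclic_product r f). \<forall>C. certificate_for f r w C \<longrightarrow>
         (\<forall>w' \<in> connected_component_set (- amoeba f) w.
            amoeba_order f w' = (\<chi> j. of_int (\<Phi> C $ j)))"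
    by blast
qed

end
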